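(* Let $\Omega\subset\mathbb{R}^n$ be a bounded domain with smooth boundary and let $\Gamma=\partial\Omega'$ for some domain $\Omega'\subset\subset\Omega$ with $C^{1,\beta}$-boundary for some $\beta\in(0,1)$. Let $Q\in L^1(\Gamma)$ and let $v\in L^1(\Omega)$ be the weak solution of $$-\Delta v=Q\,\mathcal{H}^{n-1}\llcorner\Gamma\ \text{ in }\Omega,\qquad v=0\ \text{ on }\partial\Omega.$$ Then $v\notin C^1(\Omega)$ unless $Q=0$ ($\mathcal{H}^{n-1}$-a.e. on $\Gamma$).
   Context: $L^1(\Gamma)$ means $L^1(\Gamma,\mathcal{H}^{n-1}\llcorner\Gamma)$. A function $v\in L^1(\Omega)$ is a weak solution of $-\Delta v=Q\,\mathcal{H}^{n-1}\llcorner\Gamma$ in $\Omega$, $v=0$ on $\partial\Omega$, if for all $\phi\in C^2(\overline{\Omega})$ with $\phi|_{\partial\Omega}=0$ one has $-\int_\Omega v\,\Delta\phi\,dx=\int_\Gamma Q\,\phi\,d\mathcal{H}^{n-1}$. Such a weak solution exists and is unique. *)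

theory Defs
  imports "HOL-Analysis.Analysis"
begin

section \<open>Hausdorff measure of integer dimension\<close>

text \<open>
  The boundedness requirement is needed because \<^const>\<open>diameter\<close> is a real supremum and hence
  unspecified on unbounded sets. The nat power gives \<open>0 ^ 0 = 1\<close>, so that the zero-dimensional measure
  counts points; the empty set contributes nothing in any dimension.
\<close>

definition hausdorff_gauge :: "nat \<Rightarrow> 'a::metric_space set \<Rightarrow> ennreal" where
  "hausdorff_gauge k C =
     (if C = {} then 0 else ennreal (unit_ball_vol (real k) * (diameter C / 2) ^ k))"

definition hausdorff_content :: "nat \<Rightarrow> real \<Rightarrow> 'a::metric_space set \<Rightarrow> ennreal" where
  "hausdorff_content k \<delta> A =
     (INF C \<in> {C :: nat \<Rightarrow> 'a set. A \<subseteq> (\<Union>i. C i) \<and> (\<forall>i. bounded (C i) \<and> diameter (C i) \<le> \<delta>)}.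
        \<Sum>i. hausdorff_gauge k (C i))"

definition hausdorff_outer :: "nat \<Rightarrow> 'a::metric_space set \<Rightarrow> ennreal" where
  "hausdorff_outer k A = (SUP \<delta> \<in> {0<..}. hausdorff_content k \<delta> A)"

text \<open>The sigma-algebra consists of all Caratheodory-measurable sets.\<close>

definition hausdorff_measure :: "nat \<Rightarrow> 'a::metric_space measure" where
  "hausdorff_measure k =
     measure_of UNIV (lambda_system UNIV UNIV (hausdorff_outer k)) (hausdorff_outer k)"

lemma hausdorff_content_mono: "A \<subseteq> B \<Longrightarrow> hausdorff_content k \<delta> A \<le> hausdorff_content k \<delta> B"
  unfolding hausdorff_content_def by (rule INF_superset_mono) auto

lemma hausdorff_content_empty: "\<delta> > 0 \<Longrightarrow> hausdorff_content k \<delta> {} = 0"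
proof -
  assume "\<delta> > 0"
  then have "hausdorff_content k \<delta> ({}::'a set) \<le> (\<Sum>i. hausdorff_gauge k ((\<lambda>_. {}::'a set) (i::nat)))"
    unfolding hausdorff_content_def by (intro INF_lower) auto
  then show ?thesis by (simp add: hausdorff_gauge_def)
qed

lemma hausdorff_content_UN:
  fixes A :: "nat \<Rightarrow> 'a::metric_space set"
  shows "hausdorff_content k \<delta> (\<Union>i. A i) \<le> (\<Sum>i. hausdorff_content k \<delta> (A i))"
proof (rule ennreal_le_epsilon)
  fix e :: real
  assume fin: "(\<Sum>i. hausdorff_content k \<delta> (A i)) < top" and e: "0 < e"
  let ?S = "\<lambda>n. {C :: nat \<Rightarrow> 'a set. A n \<subseteq> (\<Union>i. C i) \<and> (\<forall>i. bounded (C i) \<and> diameter (C i) \<le> \<delta>)}"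
  have "\<exists>C\<in>?S n. (\<Sum>i. hausdorff_gauge k (C i)) \<le> hausdorff_content k \<delta> (A n) + ennreal (e * (1/2) ^ Suc n)"
    for n
  proof -
    have "hausdorff_content k \<delta> (A n) \<noteq> top"
      using ennreal_suminf_lessD[OF fin, of n] by auto
    then have "hausdorff_content k \<delta> (A n) < hausdorff_content k \<delta> (A n) + ennreal (e * (1/2) ^ Suc n)"
      using e by (simp add: ennreal_zero_less_divide less_top)
    then show ?thesis
      unfolding hausdorff_content_def[of _ _ "A n"] INF_less_iff by (blast intro: less_imp_le)
  qed
  then have "\<forall>n. \<exists>C. C \<in> ?S n \<and> (\<Sum>i. hausdorff_gauge k (C i)) \<le> hausdorff_content k \<delta> (A n) + ennreal (e * (1/2) ^ Suc n)"
    by blast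
  from choice[OF this] obtain C where C: "\<And>n. C n \<in> ?S n"
    and le: "\<And>n. (\<Sum>i. hausdorff_gauge k (C n i)) \<le> hausdorff_content k \<delta> (A n) + ennreal (e * (1/2) ^ Suc n)"
    by blast
  define D where "D = case_prod C \<circ> prod_decode"
  have "(\<Union>i. A i) \<subseteq> (\<Union>i. D i)"
  proof
    fix x assume "x \<in> (\<Union>i. A i)"
    then obtain n m where "x \<in> C n m" using C by blast
    then have "x \<in> D (prod_encode (n, m))" by (simp add: D_def)
    then show "x \<in> (\<Union>i. D i)" by blast
  qed
  then have "hausdorff_content k \<delta> (\<Union>i. A i) \<le> (\<Sum>i. hausdorff_gauge k (D i))"
    unfolding hausdorff_content_def using C by (intro INF_lower) (auto simp: D_def split: prod.split)
  also have "\<dots> = (\<Sum>n. \<Sum>i. hausdorff_gauge k (C n i))"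
    using suminf_ennreal_2dimen[where f = "\<lambda>(n, i). hausdorff_gauge k (C n i)"
        and g = "\<lambda>n. \<Sum>i. hausdorff_gauge k (C n i)"]
    by (simp add: D_def comp_def case_prod_unfold)
  also have "\<dots> \<le> (\<Sum>n. hausdorff_content k \<delta> (A n) + ennreal (e * (1/2) ^ Suc n))"
    by (intro suminf_le le summableI)
  also have "\<dots> = (\<Sum>n. hausdorff_content k \<delta> (A n)) + (\<Sum>n. ennreal (e * (1/2) ^ Suc n))"
    by (rule suminf_add[symmetric]) auto
  also have "(\<Sum>n. ennreal (e * (1/2) ^ Suc n)) = ennreal e"
  proof -
    have "(\<lambda>n. e * (1/2) ^ Suc n) sums (e * 1)"
      by (intro sums_mult power_half_series)
    then show ?thesis using e by (intro suminf_ennreal_eq) auto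
  qed
  finally show "hausdorff_content k \<delta> (\<Union>i. A i) \<le> (\<Sum>i. hausdorff_content k \<delta> (A i)) + ennreal e" .
qed

lemma outer_measure_space_hausdorff_outer:
  "outer_measure_space UNIV (hausdorff_outer k :: 'a::metric_space set \<Rightarrow> ennreal)"
    (is "outer_measure_space UNIV ?H")
  unfolding outer_measure_space_def
proof (intro conjI)
  show "positive UNIV ?H"
    by (simp add: positive_def hausdorff_outer_def hausdorff_content_empty)
  show "increasing UNIV ?H"
    unfolding increasing_def hausdorff_outer_def
    by (intro ballI impI SUP_mono) (blast intro: hausdorff_content_mono)
  show "countably_subadditive UNIV ?H"
    unfolding countably_subadditive_def
  proof (intro allI impI)
    fix A :: "nat \<Rightarrow> 'a set"
    show "hausdorff_outer k (\<Union>i. A i) \<le> (\<Sum>i. hausdorff_outer k (A i))"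
      unfolding hausdorff_outer_def[of _ "\<Union>i. A i"]
    proof (rule SUP_least)
      fix \<delta> :: real assume "\<delta> \<in> {0<..}"
      then have "(\<Sum>i. hausdorff_content k \<delta> (A i)) \<le> (\<Sum>i. hausdorff_outer k (A i))"
        unfolding hausdorff_outer_def by (intro suminf_le summableI SUP_upper)
      then show "hausdorff_content k \<delta> (\<Union>i. A i) \<le> (\<Sum>i. hausdorff_outer k (A i))"
        by (rule order_trans[OF hausdorff_content_UN])
    qed
  qed
qed

lemma measure_space_hausdorff:
  "measure_space UNIV (lambda_system UNIV UNIV (hausdorff_outer k)) (hausdorff_outer k)"
  using sigma_algebra.caratheodory_lemma[OF sigma_algebra_Pow[of UNIV], unfolded Pow_UNIV]
    outer_measure_space_hausdorff_outer by blast

lemma space_hausdorff_measure [simp]: "space (hausdorff_measure k) = UNIV"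
  by (simp add: hausdorff_measure_def space_measure_of_conv)

lemma sets_hausdorff_measure:
  "sets (hausdorff_measure k :: 'a::metric_space measure) = lambda_system UNIV UNIV (hausdorff_outer k)"
    (is "_ = ?L")
proof -
  have "sigma_algebra UNIV ?L"
    using measure_space_hausdorff[of k] unfolding measure_space_def by blast
  then show ?thesis
    unfolding hausdorff_measure_def by (rule sigma_algebra.sets_measure_of_eq)
qed

lemma emeasure_hausdorff_measure:
  fixes A :: "'a::metric_space set"
  assumes "A \<in> sets (hausdorff_measure k)"
  shows "emeasure (hausdorff_measure k) A = hausdorff_outer k A"
proof -
  let ?H = "hausdorff_outer k :: 'a set \<Rightarrow> ennreal"
  let ?L = "lambda_system UNIV UNIV ?H"
  have *: "sigma_algebra UNIV ?L" "positive ?L ?H" "countably_additive ?L ?H"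
    using measure_space_hausdorff[of k] unfolding measure_space_def by blast+
  show ?thesis
    unfolding hausdorff_measure_def
    by (rule emeasure_measure_of_sigma[OF *]) (use assms in \<open>simp only: sets_hausdorff_measure\<close>)
qed


section \<open>Function spaces\<close>

definition pderivative :: "'a::euclidean_space \<Rightarrow> ('a \<Rightarrow> real) \<Rightarrow> 'a \<Rightarrow> real" where
  "pderivative i f x = frechet_derivative f (at x) i"

definition laplacian :: "('a::euclidean_space \<Rightarrow> real) \<Rightarrow> 'a \<Rightarrow> real" where
  "laplacian f x = (\<Sum>i\<in>Basis. pderivative i (pderivative i f) x)"

text \<open>\<open>Ck_on k f U\<close> is \<open>f \<in> C\<^sup>k(U)\<close> for open \<open>U\<close>.\<close>

primrec Ck_on :: "nat \<Rightarrow> ('a::euclidean_space \<Rightarrow> real) \<Rightarrow> 'a set \<Rightarrow> bool" where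
  "Ck_on 0 f U \<longleftrightarrow> continuous_on U f"
| "Ck_on (Suc k) f U \<longleftrightarrow>
     (\<forall>x\<in>U. f differentiable (at x)) \<and> (\<forall>i\<in>Basis. Ck_on k (pderivative i f) U)"

definition smooth_fun_on :: "('a::euclidean_space \<Rightarrow> real) \<Rightarrow> 'a set \<Rightarrow> bool" where
  "smooth_fun_on f U \<longleftrightarrow> (\<forall>k. Ck_on k f U)"

definition C1_holder_on :: "real \<Rightarrow> ('a::euclidean_space \<Rightarrow> real) \<Rightarrow> 'a set \<Rightarrow> bool" where
  "C1_holder_on \<beta> f U \<longleftrightarrow> Ck_on 1 f U \<and>
     (\<exists>L. \<forall>i\<in>Basis. \<forall>x\<in>U. \<forall>y\<in>U. \<bar>pderivative i f x - pderivative i f y\<bar> \<le> L * dist x y powr \<beta>)"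

text \<open>
  \<open>Ck_closure k f U\<close> is \<open>f \<in> C\<^sup>k\<close> on the closure of the open set \<open>U\<close>: all derivatives of order
  at most \<open>k\<close> exist in \<open>U\<close> and extend continuously to the closure, and \<open>f\<close> is its own extension.
\<close>

definition extends_to_closure :: "('a::euclidean_space \<Rightarrow> real) \<Rightarrow> 'a set \<Rightarrow> bool" where
  "extends_to_closure f U \<longleftrightarrow> (\<exists>g. continuous_on (closure U) g \<and> (\<forall>x\<in>U. g x = f x))"

primrec Ck_extends :: "nat \<Rightarrow> ('a::euclidean_space \<Rightarrow> real) \<Rightarrow> 'a set \<Rightarrow> bool" where
  "Ck_extends 0 f U \<longleftrightarrow> extends_to_closure f U"
| "Ck_extends (Suc k) f U \<longleftrightarrow> extends_to_closure f U \<and>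
     (\<forall>x\<in>U. f differentiable (at x)) \<and> (\<forall>i\<in>Basis. Ck_extends k (pderivative i f) U)"

definition Ck_closure :: "nat \<Rightarrow> ('a::euclidean_space \<Rightarrow> real) \<Rightarrow> 'a set \<Rightarrow> bool" where
  "Ck_closure k f U \<longleftrightarrow> continuous_on (closure U) f \<and> Ck_extends k f U"

text \<open>Elements of \<open>L\<^sup>1\<close> are classes modulo null sets, so membership in \<open>C\<^sup>1(U)\<close> means having a
  \<open>C\<^sup>1\<close> representative.\<close>

definition has_C1_representative :: "('a::euclidean_space \<Rightarrow> real) \<Rightarrow> 'a set \<Rightarrow> bool" where
  "has_C1_representative v U \<longleftrightarrow> (\<exists>w. Ck_on 1 w U \<and> (AE x in lebesgue_on U. v x = w x))"


section \<open>Domains\<close>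

definition is_domain :: "'a::euclidean_space set \<Rightarrow> bool" where
  "is_domain U \<longleftrightarrow> open U \<and> connected U \<and> U \<noteq> {}"

text \<open>
  Near every boundary point, \<open>U\<close> is the region strictly above a graph over the hyperplane orthogonal to
  some unit vector \<open>e\<close>. The graph function \<open>\<gamma>\<close> is taken on the whole space, but only its values on
  that hyperplane matter; a function on the hyperplane of class \<open>P\<close> yields one on the whole space by
  composition with the orthogonal projection.
\<close>

definition boundary_of_class :: "(('a::euclidean_space \<Rightarrow> real) \<Rightarrow> bool) \<Rightarrow> 'a set \<Rightarrow> bool" where
  "boundary_of_class P U \<longleftrightarrow>
     (\<forall>p\<in>frontier U. \<exists>r>0. \<exists>e \<gamma>. norm e = 1 \<and> P \<gamma> \<and>
        U \<inter> ball p r = {x \<in> ball p r. x \<bullet> e > \<gamma> (x - (x \<bullet> e) *\<^sub>R e)})"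

definition smooth_boundary :: "'a::euclidean_space set \<Rightarrow> bool" where
  "smooth_boundary U \<longleftrightarrow> boundary_of_class (\<lambda>\<gamma>. smooth_fun_on \<gamma> UNIV) U"

definition C1_holder_boundary :: "real \<Rightarrow> 'a::euclidean_space set \<Rightarrow> bool" where
  "C1_holder_boundary \<beta> U \<longleftrightarrow> boundary_of_class (\<lambda>\<gamma>. C1_holder_on \<beta> \<gamma> UNIV) U"

definition compactly_contained :: "'a::euclidean_space set \<Rightarrow> 'a set \<Rightarrow> bool" where
  "compactly_contained V U \<longleftrightarrow> compact (closure V) \<and> closure V \<subseteq> U"


section \<open>Weak solutions with a surface source\<close>

definition surface_measure :: "'a::euclidean_space set \<Rightarrow> 'a measure" where
  "surface_measure \<Gamma> = restrict_space (hausdorff_measure (DIM('a) - 1)) \<Gamma>"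

definition weak_solution ::
  "'a::euclidean_space set \<Rightarrow> 'a set \<Rightarrow> ('a \<Rightarrow> real) \<Rightarrow> ('a \<Rightarrow> real) \<Rightarrow> bool" where
  "weak_solution \<Omega> \<Gamma> Q v \<longleftrightarrow> integrable (lebesgue_on \<Omega>) v \<and>
     (\<forall>\<phi>. Ck_closure 2 \<phi> \<Omega> \<and> (\<forall>x\<in>frontier \<Omega>. \<phi> x = 0) \<longrightarrow>
        - (\<integral>x. v x * laplacian \<phi> x \<partial>lebesgue_on \<Omega>) = (\<integral>x. Q x * \<phi> x \<partial>surface_measure \<Gamma>))"

end

theory Submission
  imports Defs
begin

text \<open>
  Suppose \<open>v\<close> is represented by a \<open>C\<^sup>1\<close> function \<open>w\<close>. Integrating by parts, every compactly supported
  \<open>C\<^sup>2\<close> test function satisfies \<open>\<integral>\<^bsub>\<Gamma>\<^esub> Q \<phi> = \<integral> \<nabla>w \<bullet> \<nabla>\<phi>\<close>. Near a point of \<open>\<Gamma>\<close>, write \<open>\<Gamma> = {h = 0}\<close> with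
  \<open>h (x + t e) = h x + t\<close>, and test with \<open>\<phi> = \<psi> \<theta>\<^sub>\<epsilon>\<close>, where \<open>\<theta>\<^sub>\<epsilon>\<close> equals \<open>1\<close> on \<open>\<Gamma>\<close>, is supported in a layer of
  width comparable to \<open>\<epsilon>\<close>, and is a difference of two translates along \<open>e\<close> of one profile with gradient of order \<open>1 / \<epsilon>\<close>.
  Moving the translations onto the continuous field \<open>\<psi> \<nabla>w\<close> shows that the right-hand side tends to \<open>0\<close>
  with \<open>\<epsilon>\<close>, while the left-hand side is always \<open>\<integral>\<^bsub>\<Gamma>\<^esub> Q \<psi>\<close>. Hence \<open>Q\<close> annihilates all \<open>\<psi>\<close>, and it vanishes almost everywhere
  because Hausdorff measure is Borel regular. Since \<open>h\<close> is only \<open>C\<^sup>1\<close>, it is mollified at a scale depending on \<open>\<epsilon>\<close>.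
\<close>

section \<open>Hausdorff measure is a Borel regular metric outer measure\<close>

text \<open>The obstacle is a scaling balance: a gradient of size \<open>1 / \<epsilon>\<close> on a
  layer of volume comparable to \<open>\<epsilon>\<close> contributes a bounded amount, which
  estimates by absolute values cannot make small. The gain comes from cancellation. The two sides of
  the cutoff contribute with opposite signs, and they match exactly after translation because the
  level function increases at unit speed along \<open>e\<close>. What survives is the oscillation of
  a continuous field over a distance \<open>3 * \<epsilon>\<close>.

  Mollification is forced because only C^2 test functions are admissible. It is harmless:
  convolution commutes with translations and preserves bounds on first derivatives, and second
  derivatives, which may blow up with the scale, never enter the estimate.

  On the measure side, \<open>Q\<close> is measurable only for the Caratheodory sigma-algebra, while
  test functions detect Borel sets. Borel hulls close this gap, but only for sets of finite measure,
  hence the positive thresholds \<open>1 / (n + 1)\<close>.\<close>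

lemma hausdorff_outer_mono: "A \<subseteq> B \<Longrightarrow> hausdorff_outer k A \<le> hausdorff_outer k B"
  unfolding hausdorff_outer_def by (intro SUP_mono) (blast intro: hausdorff_content_mono)

lemma hausdorff_outer_empty [simp]: "hausdorff_outer k {} = 0"
  by (simp add: hausdorff_outer_def hausdorff_content_empty)

lemma hausdorff_outer_UN:
  fixes A :: "nat \<Rightarrow> 'a::metric_space set"
  shows "hausdorff_outer k (\<Union>i. A i) \<le> (\<Sum>i. hausdorff_outer k (A i))"
  unfolding hausdorff_outer_def[of _ "\<Union>i. A i"]
proof (rule SUP_least)
  fix \<delta> :: real assume "\<delta> \<in> {0<..}"
  then have "(\<Sum>i. hausdorff_content k \<delta> (A i)) \<le> (\<Sum>i. hausdorff_outer k (A i))"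
    unfolding hausdorff_outer_def by (intro suminf_le summableI SUP_upper)
  then show "hausdorff_content k \<delta> (\<Union>i. A i) \<le> (\<Sum>i. hausdorff_outer k (A i))"
    by (rule order_trans[OF hausdorff_content_UN])
qed

lemma hausdorff_outer_Un: "hausdorff_outer k (A \<union> B) \<le> hausdorff_outer k A + hausdorff_outer k B"
proof -
  have "hausdorff_outer k (\<Union>i. binaryset A B i) \<le> (\<Sum>i. hausdorff_outer k (binaryset A B i))"
    by (rule hausdorff_outer_UN)
  also have "\<dots> = hausdorff_outer k A + hausdorff_outer k B"
    by (rule suminf_binaryset_eq) simp
  finally show ?thesis by (simp add: UN_binaryset_eq)
qed

lemma hausdorff_content_antimono: "\<delta> \<le> \<delta>' \<Longrightarrow> hausdorff_content k \<delta>' A \<le> hausdorff_content k \<delta> A"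
  unfolding hausdorff_content_def by (rule INF_superset_mono) (auto intro: order_trans)

text \<open>A covering set of diameter at most \<open>\<delta>\<close> cannot meet both
  \<open>A\<close> and \<open>B\<close>. Sorting a cover of the union by which of the two sets is
  met yields two covers whose gauges together do not exceed the original sum.\<close>

lemma hausdorff_content_separated:
  fixes A B :: "'a::metric_space set"
  assumes "\<And>x y. x \<in> A \<Longrightarrow> y \<in> B \<Longrightarrow> \<delta> < dist x y"
  shows "hausdorff_content k \<delta> A + hausdorff_content k \<delta> B \<le> hausdorff_content k \<delta> (A \<union> B)"
  unfolding hausdorff_content_def[of _ _ "A \<union> B"]
proof (rule INF_greatest)
  fix C :: "nat \<Rightarrow> 'a set"
  assume "C \<in> {C. A \<union> B \<subseteq> (\<Union>i. C i) \<and> (\<forall>i. bounded (C i) \<and> diameter (C i) \<le> \<delta>)}"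
  then have cov: "A \<union> B \<subseteq> (\<Union>i. C i)" and bd: "\<And>i. bounded (C i)" and di: "\<And>i. diameter (C i) \<le> \<delta>"
    by auto
  \<comment> \<open>Discarded covering sets are replaced by \<open>{}\<close>, whose diameter 0 must
    also respect the mesh bound.\<close>
  have \<delta>0: "0 \<le> \<delta>"
    using di[of 0] diameter_ge_0[OF bd[of 0]] by linarith
  define D where "D S i = (if C i \<inter> S = {} then {} else C i)" for S i
  have le: "hausdorff_content k \<delta> S \<le> (\<Sum>i. hausdorff_gauge k (D S i))" if "S \<subseteq> A \<union> B" for S
    unfolding hausdorff_content_def using cov bd di \<delta>0 that
    by (intro INF_lower) (auto simp: D_def subset_eq; blast)
  have "hausdorff_gauge k (D A i) + hausdorff_gauge k (D B i) \<le> hausdorff_gauge k (C i)" for i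
  proof (cases "C i \<inter> A = {} \<or> C i \<inter> B = {}")
    case True
    then show ?thesis by (auto simp: D_def hausdorff_gauge_def)
  next
    case False
    then obtain x y where "x \<in> C i" "x \<in> A" "y \<in> C i" "y \<in> B" by blast
    then show ?thesis
      using assms[of x y] diameter_bounded_bound[OF bd[of i], of x y] di[of i] by force
  qed
  then have "(\<Sum>i. hausdorff_gauge k (D A i) + hausdorff_gauge k (D B i)) \<le> (\<Sum>i. hausdorff_gauge k (C i))"
    by (intro suminf_le summableI)
  moreover have "(\<Sum>i. hausdorff_gauge k (D A i) + hausdorff_gauge k (D B i))
      = (\<Sum>i. hausdorff_gauge k (D A i)) + (\<Sum>i. hausdorff_gauge k (D B i))"
    by (rule suminf_add[symmetric]) auto
  ultimately show "hausdorff_content k \<delta> A + hausdorff_content k \<delta> B \<le> (\<Sum>i. hausdorff_gauge k (C i))"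
    using add_mono[OF le[of A] le[of B]] by auto
qed

lemma hausdorff_outer_separated:
  fixes A B :: "'a::metric_space set"
  assumes "0 < d" and sep: "\<And>x y. x \<in> A \<Longrightarrow> y \<in> B \<Longrightarrow> d \<le> dist x y"
  shows "hausdorff_outer k (A \<union> B) = hausdorff_outer k A + hausdorff_outer k B"
proof (rule antisym[OF hausdorff_outer_Un])
  have "hausdorff_content k a A + hausdorff_content k b B \<le> hausdorff_outer k (A \<union> B)"
    if "0 < a" "0 < b" for a b
  proof -
    \<comment> \<open>The two suprema run over independent meshes \<open>a\<close> and
      \<open>b\<close>. Contents grow as the mesh shrinks, so one common mesh below the gap
      \<open>d\<close> dominates both.\<close>
    define c where "c = min (min a b) (d / 2)"
    have c: "0 < c" "c \<le> a" "c \<le> b" "c < d"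
      using that \<open>0 < d\<close> by (auto simp: c_def)
    have "hausdorff_content k a A + hausdorff_content k b B \<le> hausdorff_content k c A + hausdorff_content k c B"
      using c by (intro add_mono hausdorff_content_antimono)
    also have "\<dots> \<le> hausdorff_content k c (A \<union> B)"
      using c sep by (intro hausdorff_content_separated) force
    also have "\<dots> \<le> hausdorff_outer k (A \<union> B)"
      unfolding hausdorff_outer_def using c by (intro SUP_upper) auto
    finally show ?thesis .
  qed
  then show "hausdorff_outer k A + hausdorff_outer k B \<le> hausdorff_outer k (A \<union> B)"
    unfolding hausdorff_outer_def[of _ A] hausdorff_outer_def[of _ B]
    by (auto simp: ennreal_SUP_add_left[symmetric] ennreal_SUP_add_right intro!: SUP_least)
qed

text \<open>Induction adds one layer at a time: the new layer has a positive gap to all earlier ones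
  simultaneously. The gap may shrink with the index, since each step uses only its own.\<close>

lemma sum_hausdorff_outer_layers:
  fixes A :: "nat \<Rightarrow> 'a::metric_space set"
  assumes "\<And>m n. m < n \<Longrightarrow> \<exists>d>0. \<forall>j\<le>m. \<forall>x\<in>A j. \<forall>y\<in>A n. d \<le> dist x y"
  shows "(\<Sum>j<N. hausdorff_outer k (A j)) = hausdorff_outer k (\<Union>j<N. A j)"
proof (induction N)
  case (Suc N)
  have "hausdorff_outer k ((\<Union>j<N. A j) \<union> A N) = hausdorff_outer k (\<Union>j<N. A j) + hausdorff_outer k (A N)"
  proof (cases N)
    case (Suc m)
    with assms[of m N] obtain d where "d > 0" "\<forall>j\<le>m. \<forall>x\<in>A j. \<forall>y\<in>A N. d \<le> dist x y" by auto
    then show ?thesis using Suc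
      by (intro hausdorff_outer_separated[of d]) (auto simp: less_Suc_eq_le)
  qed simp
  then show ?case
    by (simp add: Suc.IH lessThan_Suc Un_commute)
qed simp

text \<open>The Caratheodory criterion: since the layers of \<open>X - F\<close> at comparable distance from \<open>F\<close> have
  summable measure, the part of \<open>X\<close> that is close to, but not in, \<open>F\<close> is negligible.\<close>

lemma closed_in_sets_hausdorff_measure:
  fixes F :: "'a::metric_space set"
  assumes "closed F"
  shows "F \<in> sets (hausdorff_measure k)"
proof (cases "F = {}")
  case False
  let ?H = "hausdorff_outer k :: 'a set \<Rightarrow> ennreal"
  have main: "?H (F \<inter> X) + ?H (X - F) \<le> ?H X" for X
  proof (cases "?H X = top")
    case finX: False
    define S where "S n = {x \<in> X - F. 1 / real (n + 1) \<le> infdist x F}" for n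
    define R where "R n = {x \<in> X - F. 1 / real (n + 2) \<le> infdist x F \<and> infdist x F < 1 / real (n + 1)}" for n
    have infd: "infdist x F \<le> infdist y F + dist x y" for x y
      by (rule infdist_triangle)
    \<comment> \<open>Adjacent shells may have no gap between them, but shells of equal parity do.
      The offset \<open>c\<close> is 0 for the even and 1 for the odd indices, and each family has
      total measure at most \<open>?H X\<close>.\<close>
    have layers: "(\<Sum>j<N. ?H (R (2 * j + c))) \<le> ?H X" for c N
    proof -
      have "\<exists>d>0. \<forall>j\<le>m. \<forall>x\<in>R (2 * j + c). \<forall>y\<in>R (2 * n + c). d \<le> dist x y" if "m < n" for m n
      proof (intro exI[of _ "1 / real (2 * m + c + 2) - 1 / real (2 * n + c + 1)"] conjI allI impI ballI)
        show "0 < 1 / real (2 * m + c + 2) - 1 / real (2 * n + c + 1)"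
          using that by (auto intro!: divide_strict_left_mono)
        fix j x y assume "j \<le> m" "x \<in> R (2 * j + c)" "y \<in> R (2 * n + c)"
        moreover have "1 / real (2 * m + c + 2) \<le> 1 / real (2 * j + c + 2)"
          using \<open>j \<le> m\<close> by (auto intro!: divide_left_mono)
        ultimately show "1 / real (2 * m + c + 2) - 1 / real (2 * n + c + 1) \<le> dist x y"
          using infd[of x y] by (auto simp: R_def)
      qed
      then have "(\<Sum>j<N. ?H (R (2 * j + c))) = ?H (\<Union>j<N. R (2 * j + c))"
        by (rule sum_hausdorff_outer_layers)
      also have "\<dots> \<le> ?H X" by (rule hausdorff_outer_mono) (auto simp: R_def)
      finally show ?thesis .
    qed
    have "(\<Sum>n<2 * N. ?H (R n)) = (\<Sum>j<N. ?H (R (2 * j + 0))) + (\<Sum>j<N. ?H (R (2 * j + 1)))" for N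
      by (induction N) (auto simp: algebra_simps)
    then have "(\<Sum>n<2 * N. ?H (R n)) \<le> ?H X + ?H X" for N
      by (simp only: add_mono[OF layers layers])
    moreover have "(\<Sum>n<N. ?H (R n)) \<le> (\<Sum>n<2 * N. ?H (R n))" for N
      by (intro sum_mono2) auto
    ultimately have "(\<Sum>n<N. ?H (R n)) \<le> ?H X + ?H X" for N
      by (meson order_trans)
    then have "(\<Sum>n. ?H (R n)) \<le> ?H X + ?H X"
      unfolding suminf_eq_SUP by (intro SUP_least)
    then have finR: "(\<Sum>n. ?H (R n)) \<noteq> top"
      using finX by (auto simp: top_unique)
    define r where "r n = enn2real (?H (R n))" for n
    have Hr: "?H (R n) = ennreal (r n)" for n
      using ennreal_suminf_lessD[of "\<lambda>n. ?H (R n)" top n] finR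
      by (simp add: r_def ennreal_enn2real_if less_top)
    have r0: "0 \<le> r n" for n by (simp add: r_def)
    have sr: "summable r"
      using finR r0 by (intro summable_suminf_not_top) (auto simp: Hr)
    show ?thesis
    proof (rule ennreal_le_epsilon)
      fix e :: real assume "0 < e"
      \<comment> \<open>The shells beyond index \<open>n\<close> cost less than \<open>e\<close>;
        what remains of \<open>X - F\<close> lies in \<open>S n\<close>, which is separated from
        \<open>F\<close>.\<close>
      from suminf_exist_split[OF this sr] obtain n where n: "norm (\<Sum>i. r (i + n)) < e" by blast
      have "X - F \<subseteq> S n \<union> (\<Union>i. R (i + n))"
      proof
        fix x assume x: "x \<in> X - F"
        then have pos: "0 < infdist x F"
          using assms False in_closed_iff_infdist_zero[of F x] infdist_nonneg[of x F] by fastforce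
        show "x \<in> S n \<union> (\<Union>i. R (i + n))"
        proof (cases "1 / real (n + 1) \<le> infdist x F")
          case True then show ?thesis using x by (simp add: S_def)
        next
          case False
          define P where "P m \<longleftrightarrow> 1 / real (m + 1) \<le> infdist x F" for m
          obtain m where "P m"
            unfolding P_def using reals_Archimedean[OF pos] by (auto simp: inverse_eq_divide intro: less_imp_le)
          \<comment> \<open>Minimality places the point in the shell with index
            \<open>l - 1\<close>; as it lies outside \<open>S n\<close>, that index is at least
            \<open>n\<close>.\<close>
          define l where "l = (LEAST m. P m)"
          have "P l" and lmin: "\<And>m. m < l \<Longrightarrow> \<not> P m"
            unfolding l_def using LeastI[of P, OF \<open>P m\<close>] not_less_Least by auto
          have "\<not> l \<le> n"
          proof
            assume "l \<le> n"
            then have "1 / real (n + 1) \<le> 1 / real (l + 1)" by (auto intro!: divide_left_mono)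
            with \<open>P l\<close> False show False by (simp add: P_def)
          qed
          then obtain i where l: "l = Suc (i + n)" by (metis add.commute less_imp_Suc_add linorder_not_le)
          have "x \<in> R (i + n)"
            using x \<open>P l\<close> lmin[of "i + n"] unfolding R_def P_def l by (auto simp: add_ac)
          then show ?thesis by blast
        qed
      qed
      then have "?H (X - F) \<le> ?H (S n \<union> (\<Union>i. R (i + n)))" by (rule hausdorff_outer_mono)
      also have "\<dots> \<le> ?H (S n) + ?H (\<Union>i. R (i + n))" by (rule hausdorff_outer_Un)
      also have "\<dots> \<le> ?H (S n) + (\<Sum>i. ?H (R (i + n)))" by (intro add_left_mono hausdorff_outer_UN)
      also have "(\<Sum>i. ?H (R (i + n))) = ennreal (\<Sum>i. r (i + n))"
        unfolding Hr using r0 sr by (intro suminf_ennreal2) (auto simp: summable_iff_shift)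
      also have "?H (S n) + \<dots> \<le> ?H (S n) + ennreal e"
        using n by (intro add_left_mono ennreal_leI) auto
      finally have "?H (F \<inter> X) + ?H (X - F) \<le> (?H (F \<inter> X) + ?H (S n)) + ennreal e"
        by (metis add.assoc add_left_mono)
      also have "?H (F \<inter> X) + ?H (S n) = ?H ((F \<inter> X) \<union> S n)"
      proof (rule hausdorff_outer_separated[symmetric, of "1 / real (n + 1)"])
        fix x y assume "x \<in> F \<inter> X" "y \<in> S n"
        then show "1 / real (n + 1) \<le> dist x y"
          using infdist_le[of x F y] by (auto simp: S_def dist_commute)
      qed simp
      also have "\<dots> \<le> ?H X" by (rule hausdorff_outer_mono) (auto simp: S_def)
      finally show "?H (F \<inter> X) + ?H (X - F) \<le> ?H X + ennreal e" by (simp add: add_right_mono)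
    qed
  qed (simp add: top_unique)
  have "?H (F \<inter> X) + ?H ((UNIV - F) \<inter> X) = ?H X" for X
  proof (rule antisym)
    have "(UNIV - F) \<inter> X = X - F" by blast
    then show "?H (F \<inter> X) + ?H ((UNIV - F) \<inter> X) \<le> ?H X" using main[of X] by simp
    have "?H X \<le> ?H ((F \<inter> X) \<union> ((UNIV - F) \<inter> X))" by (rule hausdorff_outer_mono) blast
    also have "\<dots> \<le> ?H (F \<inter> X) + ?H ((UNIV - F) \<inter> X)" by (rule hausdorff_outer_Un)
    finally show "?H X \<le> ?H (F \<inter> X) + ?H ((UNIV - F) \<inter> X)" .
  qed
  then show ?thesis unfolding sets_hausdorff_measure lambda_system_def by simp
qed simp

lemma sets_borel_subset_hausdorff_measure:
  "sets borel \<subseteq> sets (hausdorff_measure k :: 'a::metric_space measure)"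
proof -
  have "sigma_sets UNIV (Collect closed) \<subseteq> sets (hausdorff_measure k :: 'a measure)"
    using closed_in_sets_hausdorff_measure sets.sigma_sets_subset[of "Collect closed" "hausdorff_measure k :: 'a measure"]
    by auto
  then show ?thesis by (simp add: borel_eq_closed)
qed

text \<open>Nearly optimal covers are taken for the meshes \<open>1 / (n + 1)\<close>, and their
  unions are intersected. Replacing each covering set by its closure makes the result Borel without
  changing any diameter, hence without changing any gauge.\<close>

lemma hausdorff_outer_borel_hull:
  fixes A :: "'a::metric_space set"
  assumes fin: "hausdorff_outer k A < top"
  obtains B where "A \<subseteq> B" "B \<in> sets borel" "hausdorff_outer k B = hausdorff_outer k A"
proof -
  define \<delta> where "\<delta> n = 1 / real (Suc n)" for n
  have \<delta>: "\<delta> n > 0" for n by (simp add: \<delta>_def)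
  have "\<exists>C. A \<subseteq> (\<Union>i. C i) \<and> (\<forall>i. bounded (C i) \<and> diameter (C i) \<le> \<delta> n) \<and>
      (\<Sum>i. hausdorff_gauge k (C i)) \<le> hausdorff_outer k A + ennreal (\<delta> n)" for n
  proof -
    have "hausdorff_content k (\<delta> n) A \<le> hausdorff_outer k A"
      unfolding hausdorff_outer_def using \<delta> by (intro SUP_upper) auto
    also have "hausdorff_outer k A < hausdorff_outer k A + ennreal (\<delta> n)"
      using \<delta>[of n] fin by (cases "hausdorff_outer k A") (auto simp: ennreal_plus[symmetric] ennreal_less_iff simp del: ennreal_plus)
    finally show ?thesis
      unfolding hausdorff_content_def INF_less_iff by (blast intro: less_imp_le)
  qed
  then obtain C where C: "\<And>n. A \<subseteq> (\<Union>i. C n i)" "\<And>n i. bounded (C n i)" "\<And>n i. diameter (C n i) \<le> \<delta> n"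
    and sum: "\<And>n. (\<Sum>i. hausdorff_gauge k (C n i)) \<le> hausdorff_outer k A + ennreal (\<delta> n)"
    by metis
  define B where "B = (\<Inter>n. \<Union>i. closure (C n i :: 'a set))"
  have AB: "A \<subseteq> B"
    unfolding B_def using C(1) closure_subset by (blast)
  have B: "B \<in> sets borel"
    unfolding B_def by (intro sets.countable_INT' sets.countable_UN') auto
  have le: "hausdorff_content k (\<delta> n) B \<le> hausdorff_outer k A + ennreal (\<delta> n)" for n
  proof -
    have "hausdorff_content k (\<delta> n) B \<le> (\<Sum>i. hausdorff_gauge k (closure (C n i)))"
      unfolding hausdorff_content_def
      by (intro INF_lower) (auto simp: B_def C diameter_closure bounded_closure)
    also have "\<dots> = (\<Sum>i. hausdorff_gauge k (C n i))"
      by (simp only: hausdorff_gauge_def diameter_closure[OF C(2)] closure_eq_empty)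
    finally show ?thesis using sum[of n] by (rule order_trans)
  qed
  have "hausdorff_outer k B \<le> hausdorff_outer k A"
    unfolding hausdorff_outer_def[of _ B]
  proof (rule SUP_least, rule ennreal_le_epsilon)
    fix d e :: real assume "d \<in> {0<..}" "0 < e"
    then have "0 < min d e" by simp
    from reals_Archimedean[OF this] obtain n where n: "\<delta> n < min d e"
      unfolding \<delta>_def inverse_eq_divide by blast
    have "hausdorff_content k d B \<le> hausdorff_content k (\<delta> n) B"
      using n by (intro hausdorff_content_antimono) auto
    also have "\<dots> \<le> hausdorff_outer k A + ennreal (\<delta> n)" by (rule le)
    also have "\<dots> \<le> hausdorff_outer k A + ennreal e"
      using n by (intro add_left_mono ennreal_leI) auto
    finally show "hausdorff_content k d B \<le> hausdorff_outer k A + ennreal e" .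
  qed
  then have "hausdorff_outer k B = hausdorff_outer k A"
    using hausdorff_outer_mono[OF AB] by (rule antisym)
  with AB B show ?thesis by (rule that)
qed

section \<open>Functions with continuous gradient\<close>

text \<open>The gradient is carried as an explicit vector field because the estimates manipulate it
  directly. Differentiability is demanded on the whole space, so that cut-off functions can be
  integrated and translated freely.\<close>

definition C1_grad :: "('a::euclidean_space \<Rightarrow> real) \<Rightarrow> ('a \<Rightarrow> 'a) \<Rightarrow> bool" where
  "C1_grad f d \<longleftrightarrow> (\<forall>x. (f has_derivative (\<lambda>v. d x \<bullet> v)) (at x)) \<and> continuous_on UNIV d"

definition C1_fun :: "('a::euclidean_space \<Rightarrow> real) \<Rightarrow> bool" where
  "C1_fun f \<longleftrightarrow> (\<exists>d. C1_grad f d)"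

text \<open>Second derivatives are only asserted to exist continuously: no bound or formula for them
  is used, as they enter only through the Laplacian in Green's identity.\<close>

definition C2_grad :: "('a::euclidean_space \<Rightarrow> real) \<Rightarrow> ('a \<Rightarrow> 'a) \<Rightarrow> bool" where
  "C2_grad f d \<longleftrightarrow> C1_grad f d \<and> (\<forall>i\<in>Basis. C1_fun (\<lambda>x. d x \<bullet> i))"

lemma C1_gradI:
  assumes "\<And>x. (f has_derivative (\<lambda>v. d x \<bullet> v)) (at x)" "continuous_on UNIV d"
  shows "C1_grad f d"
  using assms by (simp add: C1_grad_def)

lemma C1_funI: "C1_grad f d \<Longrightarrow> C1_fun f"
  by (auto simp: C1_fun_def)

lemma C1_funE: "C1_fun f \<Longrightarrow> (\<And>d. C1_grad f d \<Longrightarrow> thesis) \<Longrightarrow> thesis"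
  by (auto simp: C1_fun_def)

lemma C1_grad_has_derivative: "C1_grad f d \<Longrightarrow> (f has_derivative (\<lambda>v. d x \<bullet> v)) (at x)"
  by (simp add: C1_grad_def)

lemma C1_grad_continuous: "C1_grad f d \<Longrightarrow> continuous_on S d"
  by (meson C1_grad_def continuous_on_subset subset_UNIV)

lemma C1_grad_continuous_fun: "C1_grad f d \<Longrightarrow> continuous_on S f"
  by (meson C1_grad_has_derivative continuous_at_imp_continuous_on has_derivative_continuous)

lemma C2_grad_imp_C1_grad: "C2_grad f d \<Longrightarrow> C1_grad f d"
  by (simp add: C2_grad_def)

lemma C1_grad_unique:
  assumes "C1_grad f d" "(f has_derivative (\<lambda>v. a \<bullet> v)) (at x)"
  shows "d x = a"
proof -
  have "(\<lambda>v. d x \<bullet> v) = (\<lambda>v. a \<bullet> v)"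
    using assms C1_grad_has_derivative has_derivative_unique by blast
  then have "d x \<bullet> v = a \<bullet> v" for v by meson
  then have "(d x - a) \<bullet> (d x - a) = 0" by (simp add: inner_diff_left)
  then show ?thesis by simp
qed

lemma C1_grad_const: "C1_grad (\<lambda>_. c) (\<lambda>_. 0)"
  by (rule C1_gradI) auto

lemma C1_grad_inner: "C1_grad (\<lambda>x. x \<bullet> a) (\<lambda>_. a)"
  by (rule C1_gradI) (auto intro!: derivative_eq_intros simp: inner_commute)

lemma C1_grad_add: "C1_grad f df \<Longrightarrow> C1_grad g dg \<Longrightarrow> C1_grad (\<lambda>x. f x + g x) (\<lambda>x. df x + dg x)"
  by (rule C1_gradI)
     (auto intro!: derivative_eq_intros C1_grad_has_derivative continuous_intros
       intro: C1_grad_continuous simp: inner_add_left)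

lemma C1_grad_diff: "C1_grad f df \<Longrightarrow> C1_grad g dg \<Longrightarrow> C1_grad (\<lambda>x. f x - g x) (\<lambda>x. df x - dg x)"
  by (rule C1_gradI)
     (auto intro!: derivative_eq_intros C1_grad_has_derivative continuous_intros
       intro: C1_grad_continuous simp: inner_diff_left)

lemma C1_grad_mult:
  "C1_grad f df \<Longrightarrow> C1_grad g dg \<Longrightarrow> C1_grad (\<lambda>x. f x * g x) (\<lambda>x. f x *\<^sub>R dg x + g x *\<^sub>R df x)"
  by (rule C1_gradI)
     (auto intro!: derivative_eq_intros C1_grad_has_derivative continuous_intros
       intro: C1_grad_continuous C1_grad_continuous_fun simp: inner_add_left)

lemma C1_grad_compose:
  fixes u u' :: "real \<Rightarrow> real"
  assumes u: "\<And>s. (u has_real_derivative u' s) (at s)" and u': "continuous_on UNIV u'" and f: "C1_grad f df"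
  shows "C1_grad (\<lambda>x. u (f x)) (\<lambda>x. u' (f x) *\<^sub>R df x)"
proof (rule C1_gradI)
  fix x
  have "(u has_derivative (*) (u' (f x))) (at (f x))"
    using u by (simp add: has_field_derivative_def)
  from has_derivative_compose[OF C1_grad_has_derivative[OF f] this]
  show "((\<lambda>x. u (f x)) has_derivative (\<lambda>v. (u' (f x) *\<^sub>R df x) \<bullet> v)) (at x)" by simp
  show "continuous_on UNIV (\<lambda>x. u' (f x) *\<^sub>R df x)"
    by (intro continuous_intros continuous_on_compose2[OF u'] C1_grad_continuous[OF f]
        C1_grad_continuous_fun[OF f]) auto
qed

lemma C1_grad_shift:
  assumes "C1_grad f df"
  shows "C1_grad (\<lambda>x. f (x + a)) (\<lambda>x. df (x + a))"
proof (rule C1_gradI)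
  fix x
  have "((\<lambda>x. x + a) has_derivative (\<lambda>v. v)) (at x)" by (auto intro!: derivative_eq_intros)
  from has_derivative_compose[OF this C1_grad_has_derivative[OF assms]]
  show "((\<lambda>x. f (x + a)) has_derivative (\<lambda>v. df (x + a) \<bullet> v)) (at x)" .
  show "continuous_on UNIV (\<lambda>x. df (x + a))"
    by (rule continuous_on_compose2[OF C1_grad_continuous[OF assms, of UNIV]]) (auto intro!: continuous_intros)
qed

lemma C1_fun_add: "C1_fun f \<Longrightarrow> C1_fun g \<Longrightarrow> C1_fun (\<lambda>x. f x + g x)"
  by (metis C1_fun_def C1_grad_add)

lemma C1_fun_diff: "C1_fun f \<Longrightarrow> C1_fun g \<Longrightarrow> C1_fun (\<lambda>x. f x - g x)"
  by (metis C1_fun_def C1_grad_diff)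

lemma C1_fun_mult: "C1_fun f \<Longrightarrow> C1_fun g \<Longrightarrow> C1_fun (\<lambda>x. f x * g x)"
  by (metis C1_fun_def C1_grad_mult)

lemma C2_grad_const: "C2_grad (\<lambda>_. c) (\<lambda>_. 0)"
  by (auto simp: C2_grad_def C1_grad_const intro: C1_funI[OF C1_grad_const])

lemma C2_grad_inner: "C2_grad (\<lambda>x. x \<bullet> a) (\<lambda>_. a)"
  by (auto simp: C2_grad_def C1_grad_inner intro: C1_funI[OF C1_grad_const])

lemma C2_grad_diff: "C2_grad f df \<Longrightarrow> C2_grad g dg \<Longrightarrow> C2_grad (\<lambda>x. f x - g x) (\<lambda>x. df x - dg x)"
  unfolding C2_grad_def inner_diff_left by (auto intro!: C1_grad_diff C1_fun_diff)

lemma C2_grad_mult: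
  "C2_grad f df \<Longrightarrow> C2_grad g dg \<Longrightarrow> C2_grad (\<lambda>x. f x * g x) (\<lambda>x. f x *\<^sub>R dg x + g x *\<^sub>R df x)"
  unfolding C2_grad_def inner_add_left inner_scaleR_left
  by (auto intro!: C1_grad_mult C1_fun_add C1_fun_mult intro: C1_funI)

lemma C2_grad_compose:
  fixes u u' u'' :: "real \<Rightarrow> real"
  assumes u: "\<And>s. (u has_real_derivative u' s) (at s)" "\<And>s. (u' has_real_derivative u'' s) (at s)"
    and u'': "continuous_on UNIV u''" and f: "C2_grad f df"
  shows "C2_grad (\<lambda>x. u (f x)) (\<lambda>x. u' (f x) *\<^sub>R df x)"
proof -
  have "continuous_on UNIV u'"
    using u(2) by (meson DERIV_isCont continuous_at_imp_continuous_on)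
  with C1_grad_compose[OF u(1) _ C2_grad_imp_C1_grad[OF f]]
  have 1: "C1_grad (\<lambda>x. u (f x)) (\<lambda>x. u' (f x) *\<^sub>R df x)" by blast
  have "C1_fun (\<lambda>x. u' (f x))"
    using C1_grad_compose[OF u(2) u'' C2_grad_imp_C1_grad[OF f]] by (rule C1_funI)
  with 1 f show ?thesis
    unfolding C2_grad_def inner_scaleR_left by (auto intro: C1_fun_mult)
qed

lemma C2_grad_prod:
  assumes "finite I" "\<And>i. i \<in> I \<Longrightarrow> \<exists>d. C2_grad (f i) d"
  shows "\<exists>d. C2_grad (\<lambda>x. \<Prod>i\<in>I. f i x) d"
  using assms
proof (induction I)
  case empty
  then show ?case using C2_grad_const by auto
next
  case (insert i I)
  then obtain d d' where "C2_grad (f i) d" "C2_grad (\<lambda>x. \<Prod>i\<in>I. f i x) d'" by force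
  from C2_grad_mult[OF this] insert.hyps show ?case by auto
qed

lemma C1_grad_pderivative: "C1_grad f d \<Longrightarrow> pderivative i f = (\<lambda>x. d x \<bullet> i)"
  using frechet_derivative_at[OF C1_grad_has_derivative[of f d]]
  by (auto simp: pderivative_def fun_eq_iff dest: fun_cong)

lemma C1_grad_differentiable: "C1_grad f d \<Longrightarrow> f differentiable (at x)"
  using C1_grad_has_derivative differentiableI by blast

text \<open>This certifies admissibility in the weak formulation: every derivative is continuous on
  the whole space and is its own extension to the closure.\<close>

lemma C2_grad_Ck_closure:
  assumes "C2_grad f d"
  shows "Ck_closure 2 f U"
proof -
  have ext: "extends_to_closure g U" if "C1_grad g d" for g d
    using C1_grad_continuous_fun[OF that] by (auto simp: extends_to_closure_def)
  have ext': "extends_to_closure (\<lambda>x. d x \<bullet> i) U" if "C1_grad g d" for g d i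
    using C1_grad_continuous[OF that] by (auto simp: extends_to_closure_def intro!: exI[of _ "\<lambda>x. d x \<bullet> i"] continuous_intros)
  have 1: "C1_grad f d" using assms by (rule C2_grad_imp_C1_grad)
  have "Ck_extends (Suc 0) (\<lambda>x. d x \<bullet> i) U" if "i \<in> Basis" for i
  proof -
    have "C1_fun (\<lambda>x. d x \<bullet> i)" using assms that by (simp add: C2_grad_def)
    then obtain d' where d': "C1_grad (\<lambda>x. d x \<bullet> i) d'" by (rule C1_funE)
    then show ?thesis
      by (auto simp: C1_grad_pderivative[OF d'] ext[OF d'] ext'[OF d'] C1_grad_differentiable[OF d'])
  qed
  then show ?thesis
    using C1_grad_continuous_fun[OF 1]
    by (auto simp: Ck_closure_def numeral_2_eq_2 ext[OF 1] C1_grad_differentiable[OF 1] C1_grad_pderivative[OF 1]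
        simp del: One_nat_def)
qed

lemma C1_grad_zero_outside:
  assumes f: "C1_grad f d" and "closed K" and z: "\<And>x. x \<notin> K \<Longrightarrow> f x = 0" and "x \<notin> K"
  shows "d x = 0"
proof (rule C1_grad_unique[OF f])
  have "((\<lambda>_. 0::real) has_derivative (\<lambda>v. 0 \<bullet> v)) (at x)" by simp
  then show "(f has_derivative (\<lambda>v. 0 \<bullet> v)) (at x)"
    by (rule has_derivative_transform_within_open[of _ _ _ _ "- K"]) (use assms in auto)
qed

lemma Ck_on_1_gradient:
  fixes w :: "'a::euclidean_space \<Rightarrow> real"
  assumes "Ck_on 1 w U"
  obtains d where "\<And>x. x \<in> U \<Longrightarrow> (w has_derivative (\<lambda>v. d x \<bullet> v)) (at x)" "continuous_on U d"
proof
  let ?d = "\<lambda>x. \<Sum>i\<in>Basis. pderivative i w x *\<^sub>R i"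
  fix x assume "x \<in> U"
  then have "w differentiable (at x)" using assms by simp
  then have D: "(w has_derivative frechet_derivative w (at x)) (at x)"
    by (simp add: frechet_derivative_works)
  then interpret bounded_linear "frechet_derivative w (at x)" by (rule has_derivative_bounded_linear)
  have "frechet_derivative w (at x) v = ?d x \<bullet> v" for v
  proof -
    have "frechet_derivative w (at x) v = frechet_derivative w (at x) (\<Sum>i\<in>Basis. (v \<bullet> i) *\<^sub>R i)"
      by (simp add: euclidean_representation)
    also have "\<dots> = (\<Sum>i\<in>Basis. (v \<bullet> i) * pderivative i w x)"
      by (simp add: sum scale pderivative_def)
    finally show ?thesis by (simp add: inner_sum_left inner_commute[of v] mult.commute)
  qed
  with D show "(w has_derivative (\<lambda>v. ?d x \<bullet> v)) (at x)"
    by (metis (no_types, lifting) ext has_derivative_eq_rhs)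
next
  show "continuous_on U (\<lambda>x. \<Sum>i\<in>Basis. pderivative i w x *\<^sub>R i)"
    using assms by (auto intro!: continuous_intros)
qed

text \<open>The open sets \<open>U\<close> and \<open>- K\<close> cover the space. On the first the
  product rule applies; on the second the product vanishes identically, whatever values
  \<open>w\<close> takes outside \<open>U\<close>.\<close>

lemma C1_grad_localize:
  assumes w: "\<And>x. x \<in> U \<Longrightarrow> (w has_derivative (\<lambda>v. d x \<bullet> v)) (at x)" "continuous_on U d" and "open U"
    and \<psi>: "C1_grad \<psi> d\<psi>" and K: "closed K" "K \<subseteq> U" "\<And>x. x \<notin> K \<Longrightarrow> \<psi> x = 0"
  shows "C1_grad (\<lambda>x. w x * \<psi> x) (\<lambda>x. w x *\<^sub>R d\<psi> x + \<psi> x *\<^sub>R d x)"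
proof (rule C1_gradI)
  have d\<psi>: "d\<psi> x = 0" if "x \<notin> K" for x
    using C1_grad_zero_outside[OF \<psi> K(1,3)] that by blast
  show "((\<lambda>x. w x * \<psi> x) has_derivative (\<lambda>v. (w x *\<^sub>R d\<psi> x + \<psi> x *\<^sub>R d x) \<bullet> v)) (at x)" for x
  proof (cases "x \<in> U")
    case True
    show ?thesis
      by (rule derivative_eq_intros w(1)[OF True] C1_grad_has_derivative[OF \<psi>])+ (auto simp: inner_add_left)
  next
    case False
    then have "x \<notin> K" using K by blast
    have "((\<lambda>_. 0::real) has_derivative (\<lambda>v. 0 \<bullet> v)) (at x)" by simp
    then have "((\<lambda>x. w x * \<psi> x) has_derivative (\<lambda>v. 0 \<bullet> v)) (at x)"
      by (rule has_derivative_transform_within_open[of _ _ _ _ "- K"]) (use K \<open>x \<notin> K\<close> in auto)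
    then show ?thesis using \<open>x \<notin> K\<close> by (simp add: d\<psi> K)
  qed
  have cw: "continuous_on U w"
    using w(1) by (meson continuous_at_imp_continuous_on has_derivative_continuous)
  have "continuous_on (U \<union> - K) (\<lambda>x. w x *\<^sub>R d\<psi> x + \<psi> x *\<^sub>R d x)"
  proof (rule continuous_on_open_Un)
    show "continuous_on U (\<lambda>x. w x *\<^sub>R d\<psi> x + \<psi> x *\<^sub>R d x)"
      by (intro continuous_intros cw w(2) C1_grad_continuous[OF \<psi>] C1_grad_continuous_fun[OF \<psi>])
    have "continuous_on (- K) (\<lambda>x. 0::'a)" by simp
    then show "continuous_on (- K) (\<lambda>x. w x *\<^sub>R d\<psi> x + \<psi> x *\<^sub>R d x)"
      by (rule continuous_on_eq) (simp add: d\<psi> K)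
  qed (use \<open>open U\<close> K in auto)
  moreover have "U \<union> - K = UNIV" using K by blast
  ultimately show "continuous_on UNIV (\<lambda>x. w x *\<^sub>R d\<psi> x + \<psi> x *\<^sub>R d x)" by simp
qed

section \<open>A C^2 transition profile on the real line\<close>

lemma has_real_derivative_pos_part_power:
  "((\<lambda>s::real. max 0 s ^ Suc (Suc n)) has_real_derivative real (Suc (Suc n)) * max 0 x ^ Suc n) (at x)"
proof (cases x "0::real" rule: linorder_cases)
  case less
  have "((\<lambda>s::real. 0) has_real_derivative real (Suc (Suc n)) * max 0 x ^ Suc n) (at x)"
    using less by (auto intro!: derivative_eq_intros)
  then show ?thesis
    by (rule DERIV_cong_ev[THEN iffD1, rotated -1])
       (use less in \<open>auto intro!: eventually_mono[OF eventually_nhds_in_open[of "{..<0}"]]\<close>)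
next
  case equal
  \<comment> \<open>At the kink the Caratheodory slope function is \<open>max 0 s ^ Suc n\<close>,
    which is continuous and vanishes at 0.\<close>
  show ?thesis
    unfolding CARAT_DERIV
  proof (intro exI[of _ "\<lambda>s. max 0 s ^ Suc n"] conjI allI)
    show "max 0 z ^ Suc (Suc n) - max 0 x ^ Suc (Suc n) = max 0 z ^ Suc n * (z - x)" for z
      by (cases "0 \<le> z") (auto simp: equal)
    show "isCont (\<lambda>s::real. max 0 s ^ Suc n) x" by (intro continuous_intros)
  qed (simp add: equal)
next
  case greater
  have "((\<lambda>s::real. s ^ Suc (Suc n)) has_real_derivative real (Suc (Suc n)) * max 0 x ^ Suc n) (at x)"
    using greater DERIV_pow[of "Suc (Suc n)" x] by simp
  then show ?thesis
    by (rule DERIV_cong_ev[THEN iffD1, rotated -1])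
       (use greater in \<open>auto intro!: eventually_mono[OF eventually_nhds_in_open[of "{0<..}"]]\<close>)
qed

text \<open>The witness is the primitive of the quadratic B-spline with knots \<open>0, 1/3, 2/3, 1\<close>.\<close>

lemma C2_step_function:
  obtains K K' K'' :: "real \<Rightarrow> real" and M :: real
  where "\<And>s. (K has_real_derivative K' s) (at s)" "\<And>s. (K' has_real_derivative K'' s) (at s)"
    "continuous_on UNIV K''" "\<And>s. s \<le> 0 \<Longrightarrow> K s = 0" "\<And>s. 1 \<le> s \<Longrightarrow> K s = 1"
    "\<And>s. s \<le> 0 \<or> 1 \<le> s \<Longrightarrow> K' s = 0" "\<And>s. \<bar>K s\<bar> \<le> M" "\<And>s. \<bar>K' s\<bar> \<le> M"
proof -
  define P :: "nat \<Rightarrow> real \<Rightarrow> real" where "P m s = max 0 s ^ m" for m s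
  \<comment> \<open>This is the third backward difference, with step 1/3, of the truncated power. To
    the right of 1 every truncation is inactive, so the difference annihilates degree 2 and is
    constant in degree 3.\<close>
  define T where "T m s = P m s - 3 * P m (s - 1/3) + 3 * P m (s - 2/3) - P m (s - 1)" for m s
  have P: "(P (Suc (Suc n)) has_real_derivative real (Suc (Suc n)) * P (Suc n) s) (at s)" for n s
    using has_real_derivative_pos_part_power[of n s] by (simp add: P_def[abs_def])
  have P': "((\<lambda>s. P (Suc (Suc n)) (s - c)) has_real_derivative real (Suc (Suc n)) * P (Suc n) (s - c)) (at s)" for n s c
  proof -
    have "((\<lambda>s. s - c) has_real_derivative 1) (at s)" by (auto intro!: derivative_eq_intros)
    from DERIV_chain'[OF this P] show ?thesis by simp
  qed
  have T: "(T (Suc (Suc n)) has_real_derivative real (Suc (Suc n)) * T (Suc n) s) (at s)" for n s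
    unfolding T_def
    by (rule DERIV_cong, rule DERIV_diff[OF DERIV_add[OF DERIV_diff[OF P DERIV_cmult[OF P']] DERIV_cmult[OF P']] P'])
       (simp add: algebra_simps)
  \<comment> \<open>The third difference of the cube with step 1/3 is \<open>6 / 27 = 2 / 9\<close>,
    so the factor 9/2 makes the plateau equal to 1. The factors 27/2 and 27 come from
    differentiation.\<close>
  define K K' K'' where "K s = 9/2 * T 3 s" and "K' s = 27/2 * T 2 s" and "K'' s = 27 * T 1 s" for s
  have d1: "(K has_real_derivative K' s) (at s)" for s
    using DERIV_cmult[OF T[of 1 s], of "9/2"]
    by (simp add: K_def[abs_def] K'_def numeral_3_eq_3 numeral_2_eq_2)
  have d2: "(K' has_real_derivative K'' s) (at s)" for s
    using DERIV_cmult[OF T[of 0 s], of "27/2"]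
    by (simp add: K'_def[abs_def] K''_def numeral_2_eq_2)
  have c: "continuous_on UNIV K''"
    unfolding K''_def T_def P_def by (intro continuous_intros)
  have z: "K s = 0" "K' s = 0" if "s \<le> 0" for s
    using that by (auto simp: K_def K'_def T_def P_def)
  have o: "K s = 1" "K' s = 0" if "1 \<le> s" for s
    using that by (simp_all add: K_def K'_def T_def P_def max_def power2_eq_square power3_eq_cube field_simps)
  have bd: "\<exists>M. \<forall>s\<in>{0..1}. \<bar>f s\<bar> \<le> M" if "continuous_on UNIV f" for f :: "real \<Rightarrow> real"
  proof -
    have "compact (f ` {0..1})"
      by (intro compact_continuous_image) (auto intro: continuous_on_subset[OF that])
    then show ?thesis using compact_imp_bounded bounded_real by (metis imageI)
  qed
  have "continuous_on UNIV K" "continuous_on UNIV K'"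
    using d1 d2 by (meson DERIV_isCont continuous_at_imp_continuous_on)+
  from this[THEN bd] obtain M1 M2 where M: "\<forall>s\<in>{0..1}. \<bar>K s\<bar> \<le> M1" "\<forall>s\<in>{0..1}. \<bar>K' s\<bar> \<le> M2" by blast
  have "\<bar>K s\<bar> \<le> max 1 (max M1 M2) \<and> \<bar>K' s\<bar> \<le> max 1 (max M1 M2)" for s
  proof (cases "s \<in> {0..1}")
    case True
    then have "\<bar>K s\<bar> \<le> M1" "\<bar>K' s\<bar> \<le> M2" using M by blast+
    then show ?thesis by linarith
  next
    case False
    then have "s \<le> 0 \<or> 1 \<le> s" by auto
    then show ?thesis using z[of s] o[of s] by fastforce
  qed
  with d1 d2 c z o show ?thesis by (intro that[of K K' K'' "max 1 (max M1 M2)"]) auto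
qed

section \<open>Mollification\<close>

text \<open>This passes from the Lebesgue integral over the space to the gauge integral over a cube,
  for which differentiation under the integral sign is available.\<close>

lemma
  fixes f :: "'a::euclidean_space \<Rightarrow> 'b::euclidean_space"
  assumes cont: "continuous_on UNIV f" and supp: "\<And>x. R \<le> norm x \<Longrightarrow> f x = 0"
  shows integrable_compact_support: "integrable lborel f"
    and integral_compact_support: "(\<integral>x. f x \<partial>lborel) = integral (cbox (- R *\<^sub>R One) (R *\<^sub>R One)) f"
proof -
  let ?Q = "cbox (- R *\<^sub>R One) (R *\<^sub>R One) :: 'a set"
  have "f x = 0" if "x \<notin> ?Q" for x
  proof (rule supp, rule ccontr)
    assume "\<not> R \<le> norm x"
    then have "\<bar>x \<bullet> i\<bar> \<le> R" if "i \<in> Basis" for i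
      using Basis_le_norm[OF that, of x] by linarith
    then have "x \<in> ?Q" by (fastforce simp: mem_box)
    with that show False by blast
  qed
  then have eq: "(\<lambda>x. indicator ?Q x *\<^sub>R f x) = f" by (auto simp: indicator_def fun_eq_iff)
  have "integrable lborel (\<lambda>x. indicator ?Q x *\<^sub>R f x)"
    by (rule borel_integrable_compact) (auto intro: continuous_on_subset[OF cont])
  then have "set_integrable lborel ?Q f" by (simp add: set_integrable_def)
  from set_borel_integral_eq_integral(2)[OF this] this
  show "integrable lborel f" "(\<integral>x. f x \<partial>lborel) = integral ?Q f"
    unfolding set_integrable_def set_lebesgue_integral_def eq by auto
qed

text \<open>The support in \<open>y\<close> is bounded uniformly for \<open>x\<close> in
  \<open>U\<close>, so one cube carries all the integrals and the Leibniz rule on a compact cube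
  applies.\<close>

lemma leibniz_lborel:
  fixes F :: "'a::euclidean_space \<Rightarrow> 'a \<Rightarrow> real" and dF :: "'a \<Rightarrow> 'a \<Rightarrow> 'a"
  assumes U: "open U" "convex U"
    and der: "\<And>x y. x \<in> U \<Longrightarrow> ((\<lambda>x. F x y) has_derivative (\<lambda>v. dF x y \<bullet> v)) (at x)"
    and contF: "\<And>x. x \<in> U \<Longrightarrow> continuous_on UNIV (F x)"
    and contd: "continuous_on (U \<times> UNIV) (\<lambda>(x, y). dF x y)"
    and supp: "\<And>x y. x \<in> U \<Longrightarrow> R \<le> norm y \<Longrightarrow> F x y = 0 \<and> dF x y = 0"
  shows "x \<in> U \<Longrightarrow> ((\<lambda>x. \<integral>y. F x y \<partial>lborel) has_derivative (\<lambda>v. (\<integral>y. dF x y \<partial>lborel) \<bullet> v)) (at x)"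
    and "continuous_on U (\<lambda>x. \<integral>y. dF x y \<partial>lborel)"
proof -
  let ?Q = "cbox (- R *\<^sub>R One) (R *\<^sub>R One) :: 'a set"
  have cd: "continuous_on UNIV (dF x)" if "x \<in> U" for x
  proof -
    have "continuous_on UNIV (\<lambda>y. (x, y))" by (intro continuous_intros)
    from continuous_on_compose2[OF contd this] that show ?thesis by auto
  qed
  have I: "(\<integral>y. F x y \<partial>lborel) = integral ?Q (F x)" "(\<integral>y. dF x y \<partial>lborel) = integral ?Q (dF x)"
    if "x \<in> U" for x
    using integral_compact_support[OF contF[OF that]] integral_compact_support[OF cd[OF that]] supp[OF that] by auto
  have "continuous_on (U \<times> ?Q) (\<lambda>(x, y). dF x y)" by (rule continuous_on_subset[OF contd]) auto
  then have "continuous_on U (\<lambda>x. integral ?Q (dF x))"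
    by (rule integral_continuous_on_param)
  then show "continuous_on U (\<lambda>x. \<integral>y. dF x y \<partial>lborel)"
    by (rule continuous_on_eq) (simp add: I)
  assume x: "x \<in> U"
  have "((\<lambda>x. integral ?Q (F x)) has_derivative integral ?Q (\<lambda>y. blinfun_inner_right (dF x y))) (at x within U)"
  proof (rule leibniz_rule)
    show "((\<lambda>x. F x t) has_derivative blinfun_apply (blinfun_inner_right (dF x t))) (at x within U)"
      if "x \<in> U" for x t
      using der[OF that, of t] by (auto intro: has_derivative_at_withinI)
    show "F x integrable_on ?Q" if "x \<in> U" for x
      by (rule integrable_continuous) (rule continuous_on_subset[OF contF[OF that]], simp)
    have "continuous_on (U \<times> ?Q) (\<lambda>p. blinfun_inner_right (case_prod dF p))"
      by (rule bounded_linear.continuous_on[OF bounded_linear_blinfun_inner_right])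
         (rule continuous_on_subset[OF contd], auto)
    then show "continuous_on (U \<times> ?Q) (\<lambda>(x, t). blinfun_inner_right (dF x t))"
      by (simp add: case_prod_unfold)
  qed (use x U in auto)
  also have "integral ?Q (\<lambda>y. blinfun_inner_right (dF x y)) = blinfun_inner_right (integral ?Q (dF x))"
    using integral_linear[OF integrable_continuous[of "- R *\<^sub>R One" "R *\<^sub>R One" "dF x"] bounded_linear_blinfun_inner_right]
      continuous_on_subset[OF cd[OF x]] by (auto simp: o_def)
  finally have "((\<lambda>x. integral ?Q (F x)) has_derivative (\<lambda>v. (\<integral>y. dF x y \<partial>lborel) \<bullet> v)) (at x within U)"
    by (simp add: I[OF x])
  then have "((\<lambda>x. integral ?Q (F x)) has_derivative (\<lambda>v. (\<integral>y. dF x y \<partial>lborel) \<bullet> v)) (at x)"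
    by (simp only: at_within_open[OF x U(1)])
  then show "((\<lambda>x. \<integral>y. F x y \<partial>lborel) has_derivative (\<lambda>v. (\<integral>y. dF x y \<partial>lborel) \<bullet> v)) (at x)"
    by (rule has_derivative_transform_within_open[of _ _ _ _ U]) (use U x in \<open>auto simp only: I(1)\<close>)
qed

section \<open>Invariance of Lebesgue measure and integrals of gradients\<close>

lemma lborel_integral_shift:
  fixes f :: "'a::euclidean_space \<Rightarrow> 'b::euclidean_space"
  assumes [measurable]: "f \<in> borel_measurable borel"
  shows "(\<integral>x. f (x + a) \<partial>lborel) = (\<integral>x. f x \<partial>lborel)"
proof -
  have "(\<integral>x. f x \<partial>lborel) = (\<integral>x. f x \<partial>distr lborel borel ((+) a))"
    by (simp add: lborel_distr_plus)
  also have "\<dots> = (\<integral>x. f (x + a) \<partial>lborel)"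
    by (subst integral_distr) (auto simp: add.commute)
  finally show ?thesis by simp
qed

lemma lborel_integral_reflect:
  fixes f :: "'a::euclidean_space \<Rightarrow> 'b::euclidean_space"
  assumes "continuous_on UNIV f"
  shows "(\<integral>x. f (a - x) \<partial>lborel) = (\<integral>x. f x \<partial>lborel)"
proof -
  have [measurable]: "f \<in> borel_measurable borel" using assms by (rule borel_measurable_continuous_onI)
  have "(lborel :: 'a measure) = distr lborel borel (\<lambda>x. a + (-1) *\<^sub>R x)"
    using lborel_affine[of "-1" a] by (simp add: density_1)
  then have "(\<integral>x. f x \<partial>lborel) = (\<integral>x. f x \<partial>distr lborel borel (\<lambda>x. a + (-1) *\<^sub>R x))"
    by simp
  also have "\<dots> = (\<integral>x. f (a - x) \<partial>lborel)"
    by (subst integral_distr) auto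
  finally show ?thesis by simp
qed

lemma C1_grad_zero_norm_gt:
  assumes "C1_grad f d" "\<And>x. R \<le> norm x \<Longrightarrow> f x = 0" "R < norm x"
  shows "d x = 0"
  by (rule C1_grad_zero_outside[OF assms(1), of "cball 0 R"]) (use assms in auto)

text \<open>By translation invariance the integral of \<open>f (y + x)\<close> over \<open>y\<close>
  is constant in \<open>x\<close>. Its derivative at \<open>x = 0\<close>, taken under the integral
  sign, is the integral of the gradient.\<close>

lemma integral_gradient_eq_0:
  assumes f: "C1_grad f d" and supp: "\<And>x. R \<le> norm x \<Longrightarrow> f x = 0"
  shows "(\<integral>x. d x \<partial>lborel) = 0"
proof -
  have cf: "continuous_on UNIV f" and cd: "continuous_on UNIV d"
    using C1_grad_continuous_fun[OF f] C1_grad_continuous[OF f] by auto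
  have "((\<lambda>x. \<integral>y. f (y + x) \<partial>lborel) has_derivative (\<lambda>v. (\<integral>y. d (y + 0) \<partial>lborel) \<bullet> v)) (at 0)"
  proof (rule leibniz_lborel[where U = "ball 0 1" and R = "R + 2"])
    show "((\<lambda>x. f (y + x)) has_derivative (\<lambda>v. d (y + x) \<bullet> v)) (at x)" for x y
      using C1_grad_has_derivative[OF C1_grad_shift[OF f, of y], of x] by (simp add: add.commute)
    show "continuous_on UNIV (\<lambda>y. f (y + x))" for x
      by (rule continuous_on_compose2[OF cf]) (auto intro!: continuous_intros)
    have "continuous_on (ball 0 1 \<times> UNIV) (\<lambda>p. d (snd p + fst p))"
      by (rule continuous_on_compose2[OF cd]) (auto intro!: continuous_intros)
    then show "continuous_on (ball 0 1 \<times> UNIV) (\<lambda>(x, y). d (y + x))" by (simp add: case_prod_unfold)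
    fix x y :: 'a assume "x \<in> ball 0 1" "R + 2 \<le> norm y"
    then have "R < norm (y + x)" using norm_diff_ineq[of y x] by simp
    then show "f (y + x) = 0 \<and> d (y + x) = 0"
      using supp[of "y + x"] C1_grad_zero_norm_gt[OF f supp, of R "y + x"] by auto
  qed auto
  moreover have "(\<lambda>x. \<integral>y. f (y + x) \<partial>lborel) = (\<lambda>x. \<integral>y. f y \<partial>lborel)"
    by (simp add: lborel_integral_shift[OF borel_measurable_continuous_onI[OF cf]])
  moreover have "((\<lambda>x::'a. \<integral>y. f y \<partial>lborel) has_derivative (\<lambda>v. 0)) (at 0)" by simp
  ultimately have "(\<lambda>v. (\<integral>y. d (y + 0) \<partial>lborel) \<bullet> v) = (\<lambda>v. 0)"
    by (simp only: has_derivative_unique)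
  from fun_cong[OF this, of "\<integral>y. d y \<partial>lborel"]
  have "(\<integral>y. d y \<partial>lborel) \<bullet> (\<integral>y. d y \<partial>lborel) = 0" by simp
  then show ?thesis by simp
qed

text \<open>A C^1 kernel suffices: of the two derivatives of a mollified C^1 function, one falls on
  the function and one on the kernel. The squared positive part of
  \<open>\<delta>\<^sup>2 - y \<bullet> y\<close> is such a kernel up to normalisation.\<close>

lemma mollifier_kernel:
  assumes "0 < \<delta>"
  obtains \<rho> :: "'a::euclidean_space \<Rightarrow> real" and d\<rho>
  where "C1_grad \<rho> d\<rho>" "\<And>y. 0 \<le> \<rho> y" "\<And>y. \<delta> \<le> norm y \<Longrightarrow> \<rho> y = 0" "(\<integral>y. \<rho> y \<partial>lborel) = 1"
proof -
  define \<rho>0 :: "'a \<Rightarrow> real" where "\<rho>0 y = max 0 (\<delta>\<^sup>2 - y \<bullet> y) ^ 2" for y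
  have u: "((\<lambda>s. max 0 s ^ 2) has_real_derivative 2 * max 0 s) (at s)" for s :: real
    using has_real_derivative_pos_part_power[of 0 s] by (simp add: numeral_2_eq_2)
  have q: "C1_grad (\<lambda>y::'a. \<delta>\<^sup>2 - y \<bullet> y) (\<lambda>y. (- 2) *\<^sub>R y)"
    by (rule C1_gradI) (auto intro!: derivative_eq_intros continuous_intros simp: inner_commute)
  have 0: "C1_grad \<rho>0 (\<lambda>y. (2 * max 0 (\<delta>\<^sup>2 - y \<bullet> y)) *\<^sub>R ((- 2) *\<^sub>R y))"
    unfolding \<rho>0_def by (rule C1_grad_compose[OF u _ q]) (intro continuous_intros)
  have supp: "\<rho>0 y = 0" if "\<delta> \<le> norm y" for y
    using power_mono[OF that, of 2] \<open>0 < \<delta>\<close> by (simp add: \<rho>0_def power2_norm_eq_inner)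
  have int: "integrable lborel \<rho>0"
    by (rule integrable_compact_support[OF C1_grad_continuous_fun[OF 0] supp])
  define c where "c = (\<integral>y. \<rho>0 y \<partial>lborel)"
  have "0 < c"
  proof -
    have "0 < (\<delta>\<^sup>2 - (\<delta>/2)\<^sup>2) ^ 2 * measure lborel (cball (0::'a) (\<delta>/2))"
      using \<open>0 < \<delta>\<close> content_cball_pos[of "\<delta>/2" "0::'a"] by (simp add: power2_eq_square field_simps)
    also have "\<dots> = (\<integral>y. (\<delta>\<^sup>2 - (\<delta>/2)\<^sup>2) ^ 2 * indicator (cball (0::'a) (\<delta>/2)) y \<partial>lborel)"
      by simp
    also have "\<dots> \<le> c"
      unfolding c_def
    proof (rule integral_mono[OF _ int])
      show "integrable lborel (\<lambda>y. (\<delta>\<^sup>2 - (\<delta>/2)\<^sup>2) ^ 2 * indicator (cball (0::'a) (\<delta>/2)) y :: real)"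
        by (intro integrable_mult_right integrable_real_indicator) (use emeasure_compact_finite[OF compact_cball] in auto)
      fix y :: 'a
      show "(\<delta>\<^sup>2 - (\<delta>/2)\<^sup>2) ^ 2 * indicator (cball 0 (\<delta>/2)) y \<le> \<rho>0 y"
      proof (cases "norm y \<le> \<delta>/2")
        case True
        from power_mono[OF True, of 2] have "y \<bullet> y \<le> (\<delta>/2)\<^sup>2" by (simp add: power2_norm_eq_inner)
        moreover have "0 \<le> \<delta>\<^sup>2 - (\<delta>/2)\<^sup>2" by (simp add: power2_eq_square)
        ultimately have "(\<delta>\<^sup>2 - (\<delta>/2)\<^sup>2) ^ 2 \<le> max 0 (\<delta>\<^sup>2 - y \<bullet> y) ^ 2"
          by (intro power_mono) auto
        then show ?thesis using True by (simp add: \<rho>0_def)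
      qed (simp add: \<rho>0_def)
    qed
    finally show ?thesis .
  qed
  show ?thesis
  proof (rule that)
    show "C1_grad (\<lambda>y. (1 / c) * \<rho>0 y)
        (\<lambda>y. (1 / c) *\<^sub>R ((2 * max 0 (\<delta>\<^sup>2 - y \<bullet> y)) *\<^sub>R ((- 2) *\<^sub>R y)) + \<rho>0 y *\<^sub>R 0)"
      by (rule C1_grad_mult[OF C1_grad_const 0])
    show "0 \<le> (1 / c) * \<rho>0 y" for y using \<open>0 < c\<close> by (simp add: \<rho>0_def)
    show "(1 / c) * \<rho>0 y = 0" if "\<delta> \<le> norm y" for y using supp[OF that] by simp
    show "(\<integral>y. (1 / c) * \<rho>0 y \<partial>lborel) = 1" using \<open>0 < c\<close> by (simp add: c_def)
  qed
qed

text \<open>Substituting \<open>z = x - y\<close> leaves \<open>x\<close> in the kernel alone, so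
  \<open>c\<close> need only be continuous. The support in \<open>z\<close> now moves with
  \<open>x\<close>; the argument is therefore local, on a unit ball about each point.\<close>

lemma C1_grad_convolution_kernel:
  assumes c: "continuous_on UNIV c" and \<rho>: "C1_grad \<rho> d\<rho>" and supp: "\<And>y. \<delta> \<le> norm y \<Longrightarrow> \<rho> y = 0"
  shows "C1_grad (\<lambda>x. \<integral>y. c (x - y) * \<rho> y \<partial>lborel) (\<lambda>x. \<integral>z. c z *\<^sub>R d\<rho> (x - z) \<partial>lborel)"
proof -
  have c\<rho>: "continuous_on UNIV \<rho>" and cd\<rho>: "continuous_on UNIV d\<rho>"
    using C1_grad_continuous_fun[OF \<rho>] C1_grad_continuous[OF \<rho>] by auto
  have cc: "continuous_on UNIV (\<lambda>z. c z * \<rho> (x - z))" for x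
    by (intro continuous_intros c continuous_on_compose2[OF c\<rho>]) auto
  have flip: "(\<integral>y. c (x - y) * \<rho> y \<partial>lborel) = (\<integral>z. c z * \<rho> (x - z) \<partial>lborel)" for x
    using lborel_integral_reflect[OF cc, of x x] by simp
  have loc: "((\<lambda>x. \<integral>z. c z * \<rho> (x - z) \<partial>lborel) has_derivative (\<lambda>v. (\<integral>z. c z *\<^sub>R d\<rho> (x - z) \<partial>lborel) \<bullet> v)) (at x)
    \<and> isCont (\<lambda>x. \<integral>z. c z *\<^sub>R d\<rho> (x - z) \<partial>lborel) x" for x
  proof -
    have der: "((\<lambda>x. c z * \<rho> (x - z)) has_derivative (\<lambda>v. (c z *\<^sub>R d\<rho> (x - z)) \<bullet> v)) (at x)" for x z
      using has_derivative_mult_right[OF C1_grad_has_derivative[OF C1_grad_shift[OF \<rho>, of "- z"], of x], of "c z"]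
      by simp
    have "continuous_on (ball x 1 \<times> UNIV) (\<lambda>p. c (snd p) *\<^sub>R d\<rho> (fst p - snd p))"
      by (intro continuous_intros continuous_on_compose2[OF c] continuous_on_compose2[OF cd\<rho>]) auto
    then have cont: "continuous_on (ball x 1 \<times> UNIV) (\<lambda>(x, z). c z *\<^sub>R d\<rho> (x - z))" by (simp add: case_prod_unfold)
    have s: "c z * \<rho> (x' - z) = 0 \<and> c z *\<^sub>R d\<rho> (x' - z) = 0"
      if "x' \<in> ball x 1" "norm x + 2 + \<delta> \<le> norm z" for x' z
    proof -
      have "norm z \<le> norm (x' - z) + norm (x' - x) + norm x"
        by norm
      then have "\<delta> < norm (x' - z)" using that by (simp add: dist_norm norm_minus_commute)
      then show ?thesis using supp[of "x' - z"] C1_grad_zero_norm_gt[OF \<rho> supp, of \<delta> "x' - z"] by auto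
    qed
    note L = leibniz_lborel[where U = "ball x 1" and R = "norm x + 2 + \<delta>", OF open_ball convex_ball der cc cont s]
    show ?thesis
      using L(1)[of x] L(2) by (auto simp: continuous_on_eq_continuous_at)
  qed
  show ?thesis
    unfolding flip using loc by (intro C1_gradI) (auto intro: continuous_at_imp_continuous_on)
qed

text \<open>Here the derivative falls on \<open>f\<close>, which exhibits the new gradient as an
  average of the old one and so preserves its local bounds.\<close>

lemma C1_grad_convolution:
  assumes f: "C1_grad f df" and \<rho>: "continuous_on UNIV \<rho>" and supp: "\<And>y. \<delta> \<le> norm y \<Longrightarrow> \<rho> y = 0"
  shows "C1_grad (\<lambda>x. \<integral>y. f (x - y) * \<rho> y \<partial>lborel) (\<lambda>x. \<integral>y. \<rho> y *\<^sub>R df (x - y) \<partial>lborel)"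
proof -
  have cf: "continuous_on UNIV f" and cdf: "continuous_on UNIV df"
    using C1_grad_continuous_fun[OF f] C1_grad_continuous[OF f] by auto
  have der: "((\<lambda>x. f (x - y) * \<rho> y) has_derivative (\<lambda>v. (\<rho> y *\<^sub>R df (x - y)) \<bullet> v)) (at x)" for x y
    using has_derivative_mult_left[OF C1_grad_has_derivative[OF C1_grad_shift[OF f, of "- y"], of x], of "\<rho> y"]
    by (simp add: mult.commute)
  have cc: "continuous_on UNIV (\<lambda>y. f (x - y) * \<rho> y)" for x
    by (intro continuous_intros \<rho> continuous_on_compose2[OF cf]) auto
  have "continuous_on (UNIV \<times> UNIV) (\<lambda>p. \<rho> (snd p) *\<^sub>R df (fst p - snd p))"
    by (intro continuous_intros continuous_on_compose2[OF \<rho>] continuous_on_compose2[OF cdf]) auto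
  then have cont: "continuous_on (UNIV \<times> UNIV) (\<lambda>(x, y). \<rho> y *\<^sub>R df (x - y))" by (simp add: case_prod_unfold)
  have s: "f (x - y) * \<rho> y = 0 \<and> \<rho> y *\<^sub>R df (x - y) = 0" if "\<delta> \<le> norm y" for x y
    using supp[OF that] by simp
  show ?thesis
    using leibniz_lborel[where U = UNIV and R = \<delta>, OF open_UNIV convex_UNIV der cc cont s] by (auto intro: C1_gradI)
qed

text \<open>The kernel is a probability density, so values and gradients are averaged over
  \<open>cball x \<delta>\<close> and inherit bounds valid there. In particular the gradient bound
  does not degrade as \<open>\<delta>\<close> shrinks, and a translation law for \<open>f\<close>
  passes to \<open>g\<close>.\<close>

lemma C2_mollification:
  fixes f :: "'a::euclidean_space \<Rightarrow> real"
  assumes f: "C1_grad f df" and "0 < \<delta>"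
  obtains g dg where "C2_grad g dg"
    "\<And>x \<eta>. (\<And>y. y \<in> cball x \<delta> \<Longrightarrow> \<bar>f y - f x\<bar> \<le> \<eta>) \<Longrightarrow> \<bar>g x - f x\<bar> \<le> \<eta>"
    "\<And>x L. (\<And>y. y \<in> cball x \<delta> \<Longrightarrow> norm (df y) \<le> L) \<Longrightarrow> norm (dg x) \<le> L"
    "\<And>x a c. (\<And>y. f (y + a) = f y + c) \<Longrightarrow> g (x + a) = g x + c"
proof -
  obtain \<rho> :: "'a \<Rightarrow> real" and d\<rho> where \<rho>: "C1_grad \<rho> d\<rho>" and pos: "\<And>y. 0 \<le> \<rho> y"
    and supp: "\<And>y. \<delta> \<le> norm y \<Longrightarrow> \<rho> y = 0" and one: "(\<integral>y. \<rho> y \<partial>lborel) = 1"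
    using mollifier_kernel[OF \<open>0 < \<delta>\<close>] by blast
  have c\<rho>: "continuous_on UNIV \<rho>" using C1_grad_continuous_fun[OF \<rho>] .
  have cf: "continuous_on UNIV f" and cdf: "continuous_on UNIV df"
    using C1_grad_continuous_fun[OF f] C1_grad_continuous[OF f] by auto
  have int\<rho>: "integrable lborel \<rho>" by (rule integrable_compact_support[OF c\<rho> supp])
  have int1: "integrable lborel (\<lambda>y. f (x - y) * \<rho> y)" for x
    by (rule integrable_compact_support[where R = \<delta>]) (auto intro!: continuous_intros c\<rho> continuous_on_compose2[OF cf] simp: supp)
  have int2: "integrable lborel (\<lambda>y. \<rho> y *\<^sub>R df (x - y))" for x
    by (rule integrable_compact_support[where R = \<delta>]) (auto intro!: continuous_intros c\<rho> continuous_on_compose2[OF cdf] simp: supp)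
  define g where "g x = (\<integral>y. f (x - y) * \<rho> y \<partial>lborel)" for x
  define dg where "dg x = (\<integral>y. \<rho> y *\<^sub>R df (x - y) \<partial>lborel)" for x
  have 1: "C1_grad g dg"
    unfolding g_def dg_def by (rule C1_grad_convolution[OF f c\<rho> supp])
  have "C1_fun (\<lambda>x. dg x \<bullet> i)" for i
  proof -
    have "dg x \<bullet> i = (\<integral>y. (df (x - y) \<bullet> i) * \<rho> y \<partial>lborel)" for x
      unfolding dg_def by (subst integral_inner_left[symmetric]) (auto intro: int2 simp: mult.commute)
    moreover have "C1_fun (\<lambda>x. \<integral>y. (df (x - y) \<bullet> i) * \<rho> y \<partial>lborel)"
      by (rule C1_funI[OF C1_grad_convolution_kernel[OF _ \<rho> supp]]) (intro continuous_intros cdf)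
    ultimately show ?thesis by simp
  qed
  with 1 have C2: "C2_grad g dg" by (simp add: C2_grad_def)
  show ?thesis
  proof (rule that[OF C2])
    fix x \<eta> assume \<eta>: "\<And>y. y \<in> cball x \<delta> \<Longrightarrow> \<bar>f y - f x\<bar> \<le> \<eta>"
    have "g x - f x = (\<integral>y. f (x - y) * \<rho> y - f x * \<rho> y \<partial>lborel)"
      unfolding g_def by (subst Bochner_Integration.integral_diff) (auto simp: int1 int\<rho> one)
    also have "\<bar>\<dots>\<bar> \<le> (\<integral>y. \<eta> * \<rho> y \<partial>lborel)"
      unfolding real_norm_def[symmetric]
    proof (rule Bochner_Integration.integral_norm_bound_integral)
      show "norm (f (x - y) * \<rho> y - f x * \<rho> y) \<le> \<eta> * \<rho> y" for y
      proof (cases "norm y \<le> \<delta>")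
        case True
        then have "\<bar>f (x - y) - f x\<bar> * \<rho> y \<le> \<eta> * \<rho> y"
          by (intro mult_right_mono \<eta> pos) (simp add: dist_norm)
        then show ?thesis using pos[of y] by (simp add: left_diff_distrib[symmetric] abs_mult)
      qed (simp add: supp)
    qed (auto intro!: Bochner_Integration.integrable_diff int1 int\<rho> integrable_mult_right)
    finally show "\<bar>g x - f x\<bar> \<le> \<eta>" by (simp add: one)
  next
    fix x L assume L: "\<And>y. y \<in> cball x \<delta> \<Longrightarrow> norm (df y) \<le> L"
    have "norm (dg x) \<le> (\<integral>y. L * \<rho> y \<partial>lborel)"
      unfolding dg_def
    proof (rule Bochner_Integration.integral_norm_bound_integral)
      show "norm (\<rho> y *\<^sub>R df (x - y)) \<le> L * \<rho> y" for y
      proof (cases "norm y \<le> \<delta>")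
        case True
        then have "norm (df (x - y)) * \<rho> y \<le> L * \<rho> y"
          by (intro mult_right_mono L pos) (simp add: dist_norm)
        then show ?thesis using pos[of y] by (simp add: mult.commute)
      qed (simp add: supp)
    qed (auto intro: int2 int\<rho>)
    then show "norm (dg x) \<le> L" by (simp add: one)
  next
    fix x a c assume eq: "\<And>y. f (y + a) = f y + c"
    have "f (x + a - y) = f (x - y) + c" for y using eq[of "x - y"] by (simp add: diff_add_eq)
    then have "g (x + a) = (\<integral>y. f (x - y) * \<rho> y + c * \<rho> y \<partial>lborel)"
      by (simp add: g_def distrib_right)
    also have "\<dots> = g x + c"
      unfolding g_def by (subst Bochner_Integration.integral_add) (auto simp: int1 int\<rho> one)
    finally show "g (x + a) = g x + c" .
  qed
qed

section \<open>Test functions concentrated in thin layers\<close>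

text \<open>For each coordinate, the gradient of \<open>W\<close> times the corresponding partial
  derivative of \<open>\<phi>\<close> integrates to zero. Its \<open>i\<close>-th component, summed
  over \<open>i\<close>, is the identity.\<close>

lemma green_identity:
  fixes W \<phi> :: "'a::euclidean_space \<Rightarrow> real"
  assumes W: "C1_grad W dW" and \<phi>: "C2_grad \<phi> d\<phi>" and supp: "\<And>x. R \<le> norm x \<Longrightarrow> \<phi> x = 0"
  shows "(\<integral>x. W x * laplacian \<phi> x \<partial>lborel) = - (\<integral>x. dW x \<bullet> d\<phi> x \<partial>lborel)"
proof -
  have \<phi>1: "C1_grad \<phi> d\<phi>" using \<phi> by (rule C2_grad_imp_C1_grad)
  have "\<forall>i\<in>Basis. \<exists>d. C1_grad (\<lambda>x. d\<phi> x \<bullet> i) d"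
    using \<phi> by (auto simp: C2_grad_def C1_fun_def)
  then obtain D where D: "\<And>i. i \<in> Basis \<Longrightarrow> C1_grad (\<lambda>x. d\<phi> x \<bullet> i) (D i)" by metis
  have d0: "d\<phi> x = 0" if "R < norm x" for x
    using C1_grad_zero_norm_gt[OF \<phi>1 supp that] .
  have cont: "continuous_on UNIV W" "continuous_on UNIV dW" "continuous_on UNIV d\<phi>"
    using W \<phi>1 by (auto intro: C1_grad_continuous C1_grad_continuous_fun)
  have cD: "continuous_on UNIV (D i)" if "i \<in> Basis" for i using C1_grad_continuous[OF D[OF that]] .
  \<comment> \<open>Gradients are known to vanish only strictly beyond the support radius; enlarging
    the radius by 1 at each differentiation restores a non-strict bound.\<close>
  have D0: "D i x = 0" if "i \<in> Basis" "R + 2 \<le> norm x" for i x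
    using that by (intro C1_grad_zero_norm_gt[OF D[OF that(1)], of "R + 1"]) (auto simp: d0)
  have int1: "integrable lborel (\<lambda>x. W x * (D i x \<bullet> i))" if "i \<in> Basis" for i
    by (rule integrable_compact_support[where R = "R + 2"]) (auto intro!: continuous_intros cont cD that simp: D0 that)
  have int2: "integrable lborel (\<lambda>x. (d\<phi> x \<bullet> i) * (dW x \<bullet> i))" for i
    by (rule integrable_compact_support[where R = "R + 2"]) (auto intro!: continuous_intros cont simp: d0)
  have eq: "(\<integral>x. W x * (D i x \<bullet> i) \<partial>lborel) = - (\<integral>x. (d\<phi> x \<bullet> i) * (dW x \<bullet> i) \<partial>lborel)" if i: "i \<in> Basis" for i
  proof -
    let ?d = "\<lambda>x. W x *\<^sub>R D i x + (d\<phi> x \<bullet> i) *\<^sub>R dW x"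
    have "C1_grad (\<lambda>x. W x * (d\<phi> x \<bullet> i)) ?d" by (rule C1_grad_mult[OF W D[OF i]])
    then have "(\<integral>x. ?d x \<partial>lborel) = 0"
      by (rule integral_gradient_eq_0[where R = "R + 1"]) (simp add: d0)
    moreover have "integrable lborel ?d"
      by (rule integrable_compact_support[where R = "R + 2"]) (auto intro!: continuous_intros cont cD i simp: d0 D0 i)
    ultimately have "0 = (\<integral>x. ?d x \<bullet> i \<partial>lborel)" by (simp add: integral_inner_left)
    also have "\<dots> = (\<integral>x. W x * (D i x \<bullet> i) + (d\<phi> x \<bullet> i) * (dW x \<bullet> i) \<partial>lborel)"
      by (simp add: inner_add_left)
    also have "\<dots> = (\<integral>x. W x * (D i x \<bullet> i) \<partial>lborel) + (\<integral>x. (d\<phi> x \<bullet> i) * (dW x \<bullet> i) \<partial>lborel)"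
      by (rule Bochner_Integration.integral_add[OF int1[OF i] int2])
    finally show ?thesis by simp
  qed
  have "W x * laplacian \<phi> x = (\<Sum>i\<in>Basis. W x * (D i x \<bullet> i))" for x
    by (simp add: laplacian_def C1_grad_pderivative[OF \<phi>1] C1_grad_pderivative[OF D] sum_distrib_left)
  then have "(\<integral>x. W x * laplacian \<phi> x \<partial>lborel) = (\<Sum>i\<in>Basis. \<integral>x. W x * (D i x \<bullet> i) \<partial>lborel)"
    by (simp add: Bochner_Integration.integral_sum[OF int1])
  also have "\<dots> = - (\<Sum>i\<in>Basis. \<integral>x. (d\<phi> x \<bullet> i) * (dW x \<bullet> i) \<partial>lborel)"
    by (simp add: eq sum_negf)
  also have "(\<Sum>i\<in>Basis. \<integral>x. (d\<phi> x \<bullet> i) * (dW x \<bullet> i) \<partial>lborel) = (\<integral>x. dW x \<bullet> d\<phi> x \<partial>lborel)"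
  proof -
    have "dW x \<bullet> d\<phi> x = (\<Sum>i\<in>Basis. (d\<phi> x \<bullet> i) * (dW x \<bullet> i))" for x
      by (subst euclidean_inner) (simp add: mult.commute)
    then show ?thesis by (simp add: Bochner_Integration.integral_sum[OF int2])
  qed
  finally show ?thesis .
qed

text \<open>Translating the layer by multiples of \<open>7 \<epsilon>\<close> in direction \<open>e\<close> gives about \<open>1 / \<epsilon>\<close> disjoint copies
  inside a fixed ball.\<close>

lemma layer_measure_le:
  fixes h :: "'a::euclidean_space \<Rightarrow> real"
  assumes cont: "continuous_on UNIV h" and e: "norm e = 1" and ht: "\<And>x t. h (x + t *\<^sub>R e) = h x + t"
    and \<epsilon>: "0 < \<epsilon>" "\<epsilon> \<le> 1"
  shows "measure lborel {x \<in> cball 0 R. \<bar>h x\<bar> \<le> 3 * \<epsilon>} \<le> 2 * measure lborel (cball (0::'a) (R + 7)) * \<epsilon>"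
proof -
  define A where "A = {x \<in> cball 0 R. \<bar>h x\<bar> \<le> 3 * \<epsilon>}"
  define B where "B = cball (0::'a) (R + 7)"
  have "A = cball 0 R \<inter> {x. \<bar>h x\<bar> \<le> 3 * \<epsilon>}" by (auto simp: A_def)
  moreover have "closed {x. \<bar>h x\<bar> \<le> 3 * \<epsilon>}"
    by (intro closed_Collect_le continuous_intros cont)
  ultimately have cA: "compact A" by (simp add: compact_Int_closed)
  then have [measurable]: "A \<in> sets borel" by (simp add: borel_compact)
  have finA: "emeasure lborel A < \<infinity>" "emeasure lborel B < \<infinity>"
    using emeasure_compact_finite[OF cA] emeasure_compact_finite[OF compact_cball] by (auto simp: B_def)
  have [measurable]: "B \<in> sets borel" by (simp add: B_def)
  \<comment> \<open>\<open>N\<close> lies between \<open>1 / (2 * \<epsilon>)\<close> and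
    \<open>1 / \<epsilon>\<close>. The lower bound, which uses \<open>\<epsilon> \<le> 1\<close>,
    produces the factor 2 in the estimate; the upper bound keeps every shift at most 7.\<close>
  define N where "N = nat \<lfloor>1 / \<epsilon>\<rfloor>"
  have N1: "real N \<le> 1 / \<epsilon>" using \<epsilon> by (simp add: N_def)
  have "1 / \<epsilon> < real N + 1" "1 \<le> 1 / \<epsilon>"
    using \<epsilon> floor_correct[of "1 / \<epsilon>"] unfolding N_def by auto
  moreover from this have "1 \<le> real N" by simp
  ultimately have "1 / \<epsilon> \<le> 2 * real N" by linarith
  then have N2: "1 / (2 * \<epsilon>) \<le> real N" by (simp add: field_simps)
  \<comment> \<open>Points of the layer differ in height by at most \<open>6 * \<epsilon>\<close>,
    while distinct shifts change the height by at least \<open>7 * \<epsilon>\<close>, so no point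
    lies in two copies.\<close>
  define s where "s j = (- (7 * \<epsilon> * real j)) *\<^sub>R e" for j :: nat
  have "(\<Sum>j<N. indicator A (x + s j)) \<le> (indicator B x :: real)" for x
  proof (cases "\<exists>j<N. x + s j \<in> A")
    case True
    then obtain j where j: "j < N" "x + s j \<in> A" by blast
    have hs: "h (x + s i) = h x - 7 * \<epsilon> * real i" for i
      unfolding s_def ht by simp
    have "x + s i \<notin> A" if "i \<noteq> j" for i
    proof
      assume "x + s i \<in> A"
      with j have "\<bar>h x - 7 * \<epsilon> * real i\<bar> \<le> 3 * \<epsilon>" "\<bar>h x - 7 * \<epsilon> * real j\<bar> \<le> 3 * \<epsilon>"
        by (auto simp: A_def hs)
      then have "\<bar>7 * \<epsilon> * real i - 7 * \<epsilon> * real j\<bar> \<le> 6 * \<epsilon>" by linarith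
      moreover have "\<bar>7 * \<epsilon> * real i - 7 * \<epsilon> * real j\<bar> = 7 * \<epsilon> * \<bar>real i - real j\<bar>"
        using \<epsilon> by (simp add: abs_mult right_diff_distrib[symmetric])
      ultimately have "\<epsilon> * (7 * \<bar>real i - real j\<bar>) \<le> \<epsilon> * 6" by linarith
      then have "7 * \<bar>real i - real j\<bar> \<le> 6" using \<epsilon> by simp
      moreover have "1 \<le> \<bar>real i - real j\<bar>" using that by linarith
      moreover have "\<not> 7 * a \<le> 6" if "1 \<le> a" for a :: real using that by linarith
      ultimately show False by blast
    qed
    then have "(\<Sum>i<N. indicator A (x + s i)) = (\<Sum>i<N. if i = j then 1 else (0::real))"
      using j by (intro sum.cong) auto
    also have "\<dots> = 1" using j by simp
    finally have sum1: "(\<Sum>i<N. indicator A (x + s i)) = (1::real)" .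
    have "norm (s j) \<le> 7"
    proof -
      have "\<epsilon> * real j \<le> \<epsilon> * real N" using j \<epsilon> by (intro mult_left_mono) auto
      also have "\<dots> \<le> 1" using N1 \<epsilon> by (simp add: field_simps)
      finally show ?thesis using \<epsilon> e by (simp add: s_def)
    qed
    moreover have "norm x \<le> norm (x + s j) + norm (s j)" by norm
    ultimately have "x \<in> B" using j by (auto simp: A_def B_def)
    then show ?thesis by (simp add: sum1)
  next
    case False
    then show ?thesis by (simp add: sum.neutral)
  qed
  moreover have ind: "integrable lborel (\<lambda>x. indicator A (x + a) :: real)" for a
  proof -
    have "(\<lambda>x. indicator A (x + a)) = (indicator ((\<lambda>x. x - a) ` A) :: 'a \<Rightarrow> real)"
      by (auto simp: indicator_def fun_eq_iff image_iff)
    moreover have "compact ((\<lambda>x. x - a) ` A)" by (intro compact_continuous_image continuous_intros cA)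
    ultimately show ?thesis
      using emeasure_compact_finite[of "(\<lambda>x. x - a) ` A"] by (auto simp: borel_compact)
  qed
  ultimately have "(\<integral>x. (\<Sum>j<N. indicator A (x + s j)) \<partial>lborel) \<le> (\<integral>x. indicator B x \<partial>lborel :: real)"
    using finA by (intro integral_mono) (auto intro!: Bochner_Integration.integrable_sum)
  also have "(\<integral>x. (\<Sum>j<N. indicator A (x + s j)) \<partial>lborel) = (\<Sum>j<N. \<integral>x. indicator A (x + s j) \<partial>lborel :: real)"
    by (intro Bochner_Integration.integral_sum ind)
  also have "\<dots> = (\<Sum>j<N. measure lborel A)"
    by (subst lborel_integral_shift) auto
  also have "\<dots> = real N * measure lborel A" by simp
  finally have "real N * measure lborel A \<le> measure lborel B" by simp
  moreover have "1 / (2 * \<epsilon>) * measure lborel A \<le> real N * measure lborel A"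
    using N2 by (intro mult_right_mono) auto
  ultimately have "1 / (2 * \<epsilon>) * measure lborel A \<le> measure lborel B" by linarith
  then show ?thesis using \<epsilon> by (simp add: A_def B_def field_simps)
qed

lemma continuous_norm_bound_cball:
  fixes f :: "'a::euclidean_space \<Rightarrow> 'b::real_normed_vector"
  assumes "continuous_on UNIV f"
  obtains M where "0 \<le> M" "\<And>x. norm x \<le> R \<Longrightarrow> norm (f x) \<le> M"
proof -
  have "compact (f ` cball 0 R)"
    by (intro compact_continuous_image continuous_on_subset[OF assms]) auto
  then obtain M where "\<forall>y\<in>f ` cball 0 R. norm y \<le> M"
    using compact_imp_bounded bounded_iff by blast
  then show ?thesis by (intro that[of "max 0 M"]) (auto simp: le_max_iff_disj)
qed

lemma continuous_modulus_cball:
  fixes f :: "'a::euclidean_space \<Rightarrow> 'b::metric_space"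
  assumes "continuous_on UNIV f" "0 < \<eta>"
  obtains d where "0 < d" "\<And>x y. norm x \<le> R \<Longrightarrow> norm y \<le> R \<Longrightarrow> dist x y < d \<Longrightarrow> dist (f x) (f y) < \<eta>"
proof -
  have "uniformly_continuous_on (cball 0 R) f"
    by (intro compact_uniformly_continuous continuous_on_subset[OF assms(1)]) auto
  then obtain d where "0 < d" "\<forall>x\<in>cball 0 R. \<forall>y\<in>cball 0 R. dist y x < d \<longrightarrow> dist (f y) (f x) < \<eta>"
    using assms(2) unfolding uniformly_continuous_on_def by metis
  then show ?thesis by (intro that[of d]) auto
qed

text \<open>The gradient of the product splits the integral. The part with
  \<open>\<theta> d\<psi>\<close> has a bounded integrand on a layer of volume at most
  \<open>C * \<epsilon>\<close>; the part with \<open>\<psi> d\<theta>\<close> needs the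
  cancellation. Parameters are fixed in the order \<open>\<omega>\<close>, \<open>d\<close>,
  \<open>\<epsilon>\<close>, \<open>\<delta>\<close>. This is not circular, since the bound
  \<open>L\<close> on \<open>dh\<close> also bounds \<open>dg\<close> for every
  \<open>\<delta> \<le> 1\<close>.\<close>

lemma thin_cutoff:
  fixes W \<psi> h :: "'a::euclidean_space \<Rightarrow> real"
  assumes W: "C1_grad W dW" and \<psi>: "C2_grad \<psi> d\<psi>" and supp: "\<And>x. R \<le> norm x \<Longrightarrow> \<psi> x = 0"
    and h: "C1_grad h dh" and e: "norm e = 1" and ht: "\<And>x t. h (x + t *\<^sub>R e) = h x + t" and "0 < \<eta>"
  obtains \<theta> d\<phi> where "C2_grad (\<lambda>x. \<psi> x * \<theta> x) d\<phi>" "\<And>x. h x = 0 \<Longrightarrow> norm x < R \<Longrightarrow> \<theta> x = 1"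
    "\<bar>\<integral>x. dW x \<bullet> d\<phi> x \<partial>lborel\<bar> \<le> \<eta>"
proof -
  obtain K K' K'' :: "real \<Rightarrow> real" and M :: real
    where K: "\<And>s. (K has_real_derivative K' s) (at s)" "\<And>s. (K' has_real_derivative K'' s) (at s)"
      "continuous_on UNIV K''" and K0: "\<And>s. s \<le> 0 \<Longrightarrow> K s = 0" and K1: "\<And>s. 1 \<le> s \<Longrightarrow> K s = 1"
      and K'0: "\<And>s. s \<le> 0 \<or> 1 \<le> s \<Longrightarrow> K' s = 0" and KM: "\<And>s. \<bar>K s\<bar> \<le> M" and K'M: "\<And>s. \<bar>K' s\<bar> \<le> M"
    using C2_step_function by blast
  have "0 \<le> M" using KM[of 0] by linarith
  have cK': "continuous_on UNIV K'"
    using K(2) by (meson DERIV_isCont continuous_at_imp_continuous_on)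
  have \<psi>1: "C1_grad \<psi> d\<psi>" using \<psi> by (rule C2_grad_imp_C1_grad)
  have d\<psi>0: "d\<psi> x = 0" if "R < norm x" for x using C1_grad_zero_norm_gt[OF \<psi>1 supp that] .
  have cont: "continuous_on UNIV \<psi>" "continuous_on UNIV d\<psi>" "continuous_on UNIV dW" "continuous_on UNIV h" "continuous_on UNIV dh"
    using W \<psi>1 h by (auto intro: C1_grad_continuous C1_grad_continuous_fun)
  define G where "G x = \<psi> x *\<^sub>R dW x" for x
  have cG: "continuous_on UNIV G" unfolding G_def by (intro continuous_intros cont)
  have G0: "G x = 0" if "R \<le> norm x" for x using supp[OF that] by (simp add: G_def)
  \<comment> \<open>Radius \<open>R + 3\<close> contains every point that a shift by at most
    \<open>2 * \<epsilon> \<le> 2\<close> can bring into the support of \<open>\<psi>\<close>.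
    Below, \<open>R + 4\<close> allows for mollification and \<open>R + 5\<close> for the shifts
    themselves.\<close>
  define C where "C = 2 * measure lborel (cball (0::'a) (R + 3 + 7))"
  have "0 \<le> C" by (simp add: C_def)
  obtain L where L: "0 \<le> L" "\<And>x. norm x \<le> R + 4 \<Longrightarrow> norm (dh x) \<le> L"
    using continuous_norm_bound_cball[OF cont(5), of "R + 4"] by blast
  have "continuous_on UNIV (\<lambda>x. dW x \<bullet> d\<psi> x)" by (intro continuous_intros cont)
  then obtain M2 where M2: "0 \<le> M2" "\<And>x. norm x \<le> R \<Longrightarrow> norm (dW x \<bullet> d\<psi> x) \<le> M2"
    using continuous_norm_bound_cball[of _ R] by blast
  \<comment> \<open>This oscillation makes the cancelled term at most \<open>\<eta> / 2\<close>; the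
    summand 1 keeps the denominator positive even if the product vanishes.\<close>
  define \<omega> where "\<omega> = \<eta> / (2 * (L * M * C + 1))"
  have pos: "0 < L * M * C + 1" "0 < 2 * M * M2 * C + 1"
    using L(1) M2(1) \<open>0 \<le> M\<close> \<open>0 \<le> C\<close> by (auto intro!: add_nonneg_pos)
  have "0 < \<omega>" using \<open>0 < \<eta>\<close> pos by (simp add: \<omega>_def)
  from continuous_modulus_cball[OF cG this, of "R + 5"]
  obtain d where d: "0 < d" "\<And>x y. norm x \<le> R + 5 \<Longrightarrow> norm y \<le> R + 5 \<Longrightarrow> dist x y < d \<Longrightarrow> dist (G x) (G y) < \<omega>"
    by blast
  \<comment> \<open>The three bounds serve the layer estimate, the comparison of points at distance
    \<open>3 * \<epsilon> < d\<close>, and the half \<open>\<eta> / 2\<close> allotted to the term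
    with \<open>\<theta> d\<psi>\<close>.\<close>
  define \<epsilon> where "\<epsilon> = min (min 1 (d / 4)) (\<eta> / (2 * (2 * M * M2 * C + 1)))"
  have \<epsilon>: "0 < \<epsilon>" "\<epsilon> \<le> 1" "4 * \<epsilon> \<le> d" "\<epsilon> \<le> \<eta> / (2 * (2 * M * M2 * C + 1))"
    using d(1) \<open>0 < \<eta>\<close> pos unfolding \<epsilon>_def by simp_all
  from continuous_modulus_cball[OF cont(4) \<epsilon>(1), of "R + 4"]
  obtain d' where d': "0 < d'" "\<And>x y. norm x \<le> R + 4 \<Longrightarrow> norm y \<le> R + 4 \<Longrightarrow> dist x y < d' \<Longrightarrow> dist (h x) (h y) < \<epsilon>"
    by blast
  \<comment> \<open>At this scale \<open>h\<close> oscillates by less than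
    \<open>\<epsilon>\<close>, so its zero set stays within the plateau
    \<open>\<bar>g x\<bar> \<le> \<epsilon>\<close> of the cutoff.\<close>
  define \<delta> where "\<delta> = min 1 (d' / 2)"
  have \<delta>: "0 < \<delta>" "\<delta> \<le> 1" "\<delta> < d'" using d'(1) by (auto simp: \<delta>_def min_def)
  from C2_mollification[OF h \<delta>(1)] obtain g dg where g: "C2_grad g dg"
    and gh: "\<And>x \<eta>. (\<And>y. y \<in> cball x \<delta> \<Longrightarrow> \<bar>h y - h x\<bar> \<le> \<eta>) \<Longrightarrow> \<bar>g x - h x\<bar> \<le> \<eta>"
    and dgL: "\<And>x L. (\<And>y. y \<in> cball x \<delta> \<Longrightarrow> norm (dh y) \<le> L) \<Longrightarrow> norm (dg x) \<le> L"
    and gt: "\<And>x a c. (\<And>y. h (y + a) = h y + c) \<Longrightarrow> g (x + a) = g x + c"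
    by blast
  have g1: "C1_grad g dg" using g by (rule C2_grad_imp_C1_grad)
  have cg: "continuous_on UNIV g" "continuous_on UNIV dg"
    using g1 by (auto intro: C1_grad_continuous C1_grad_continuous_fun)
  have near: "norm y \<le> R + 4" if "norm x \<le> R + 3" "y \<in> cball x \<delta>" for x y
  proof -
    have "norm y \<le> norm x + dist x y" by norm
    then show ?thesis using that \<delta>(2) by simp
  qed
  have gh: "\<bar>g x - h x\<bar> \<le> \<epsilon>" if "norm x \<le> R + 3" for x
  proof (rule gh)
    fix y assume "y \<in> cball x \<delta>"
    with d'(2)[of x y] near[OF that this] that \<delta>(3) show "\<bar>h y - h x\<bar> \<le> \<epsilon>"
      by (auto simp: dist_real_def abs_minus_commute)
  qed
  have dgL: "norm (dg x) \<le> L" if "norm x \<le> R + 3" for x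
    using near[OF that] L(2) by (intro dgL) blast
  have gt: "g (x + t *\<^sub>R e) = g x + t" for x t by (rule gt) (rule ht)
  \<comment> \<open>Invariance of the gradient along \<open>e\<close> lets both shifted integrands
    below share the same factor \<open>dg x\<close>.\<close>
  have dgt: "dg (x + t *\<^sub>R e) = dg x" for x t
  proof -
    have "((\<lambda>x. g (x + t *\<^sub>R e)) has_derivative (\<lambda>v. dg (x + t *\<^sub>R e) \<bullet> v)) (at x)"
      using C1_grad_has_derivative[OF C1_grad_shift[OF g1]] .
    then have "((\<lambda>x. g x + t - t) has_derivative (\<lambda>v. dg (x + t *\<^sub>R e) \<bullet> v - 0)) (at x)"
      unfolding gt by (intro has_derivative_diff has_derivative_const)
    then show ?thesis using C1_grad_unique[OF g1] by simp
  qed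
  \<comment> \<open>The first term rises on \<open>[-2 * \<epsilon>, -\<epsilon>]\<close> and the
    second on \<open>[\<epsilon>, 2 * \<epsilon>]\<close>. Hence \<open>u\<close> is 1 between them
    and 0 beyond, and its two slopes are shifted copies with opposite signs.\<close>
  define u u' u'' where "u s = K (s / \<epsilon> + 2) - K (s / \<epsilon> - 1)"
    and "u' s = (K' (s / \<epsilon> + 2) - K' (s / \<epsilon> - 1)) / \<epsilon>"
    and "u'' s = (K'' (s / \<epsilon> + 2) - K'' (s / \<epsilon> - 1)) / \<epsilon> / \<epsilon>" for s
  have chain: "((\<lambda>s. F (s / \<epsilon> + c)) has_real_derivative F' (s / \<epsilon> + c) / \<epsilon>) (at s)"
    if "\<And>s. (F has_real_derivative F' s) (at s)" for F F' c s
  proof -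
    have "((\<lambda>s. s / \<epsilon> + c) has_real_derivative 1 / \<epsilon>) (at s)"
      using \<epsilon>(1) by (auto intro!: derivative_eq_intros)
    from DERIV_chain'[OF this that] show ?thesis by simp
  qed
  have u: "(u has_real_derivative u' s) (at s)" for s
    using DERIV_diff[OF chain[OF K(1), of 2 s] chain[OF K(1), of "- 1" s]]
    by (simp add: u_def[abs_def] u'_def diff_divide_distrib)
  have u': "(u' has_real_derivative u'' s) (at s)" for s
    using DERIV_cdivide[OF DERIV_diff[OF chain[OF K(2), of 2 s] chain[OF K(2), of "- 1" s]], of \<epsilon>]
    by (simp add: u'_def[abs_def] u''_def diff_divide_distrib)
  have cu'': "continuous_on UNIV u''"
    unfolding u''_def using \<epsilon>(1)
    by (intro continuous_intros continuous_on_compose2[OF K(3)]) auto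
  define \<theta> where "\<theta> x = u (g x)" for x
  define d\<theta> where "d\<theta> x = u' (g x) *\<^sub>R dg x" for x
  have \<theta>: "C2_grad \<theta> d\<theta>"
    unfolding \<theta>_def d\<theta>_def by (rule C2_grad_compose[OF u u' cu'' g])
  then have c\<theta>: "continuous_on UNIV \<theta>" "continuous_on UNIV d\<theta>"
    by (auto intro: C1_grad_continuous C1_grad_continuous_fun dest!: C2_grad_imp_C1_grad)
  define d\<phi> where "d\<phi> x = \<psi> x *\<^sub>R d\<theta> x + \<theta> x *\<^sub>R d\<psi> x" for x
  have \<phi>: "C2_grad (\<lambda>x. \<psi> x * \<theta> x) d\<phi>"
    unfolding d\<phi>_def by (rule C2_grad_mult[OF \<psi> \<theta>])
  have \<theta>1: "\<theta> x = 1" if "h x = 0" "norm x < R" for x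
  proof -
    have "\<bar>g x\<bar> \<le> \<epsilon>" using gh[of x] that by simp
    then have "\<bar>g x / \<epsilon>\<bar> \<le> 1" using \<epsilon>(1) by simp
    then have "1 \<le> g x / \<epsilon> + 2" "g x / \<epsilon> - 1 \<le> 0" by linarith+
    then show ?thesis unfolding \<theta>_def u_def by (simp add: K0 K1)
  qed
  define A where "A = {x \<in> cball 0 (R + 3). \<bar>h x\<bar> \<le> 3 * \<epsilon>}"
  have "A = cball 0 (R + 3) \<inter> {x. \<bar>h x\<bar> \<le> 3 * \<epsilon>}" by (auto simp: A_def)
  moreover have "closed {x. \<bar>h x\<bar> \<le> 3 * \<epsilon>}"
    by (intro closed_Collect_le continuous_intros cont)
  ultimately have "compact A" by (simp add: compact_Int_closed)
  then have intA: "integrable lborel (\<lambda>x. c * indicator A x :: real)" for c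
    using emeasure_compact_finite[of A] by (intro integrable_mult_right) (auto simp: borel_compact)
  have "measure lborel A \<le> C * \<epsilon>"
    unfolding A_def C_def by (rule layer_measure_le[OF cont(4) e ht \<epsilon>(1,2)])
  \<comment> \<open>The cutoff lives in \<open>\<bar>g x\<bar> \<le> 2 * \<epsilon>\<close>; the
    mollification error adds one more \<open>\<epsilon>\<close> for \<open>h\<close>.\<close>
  have A_I: "x \<in> A" if "norm x \<le> R + 3" "\<bar>g x\<bar> \<le> 2 * \<epsilon>" for x
    using gh[OF that(1)] that by (auto simp: A_def)
  have I1: "\<bar>\<integral>x. \<theta> x * (dW x \<bullet> d\<psi> x) \<partial>lborel\<bar> \<le> \<eta> / 2"
  proof -
    have "norm (\<integral>x. \<theta> x * (dW x \<bullet> d\<psi> x) \<partial>lborel) \<le> (\<integral>x. (2 * M * M2) * indicator A x \<partial>lborel)"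
    proof (rule Bochner_Integration.integral_norm_bound_integral[OF _ intA])
      show "integrable lborel (\<lambda>x. \<theta> x * (dW x \<bullet> d\<psi> x))"
        by (rule integrable_compact_support[where R = "R + 1"]) (auto intro!: continuous_intros c\<theta> cont simp: d\<psi>0)
      fix x
      show "norm (\<theta> x * (dW x \<bullet> d\<psi> x)) \<le> 2 * M * M2 * indicator A x"
      proof (cases "norm x \<le> R \<and> \<theta> x \<noteq> 0")
        case True
        have "\<bar>g x / \<epsilon>\<bar> \<le> 2"
        proof (rule ccontr)
          assume "\<not> \<bar>g x / \<epsilon>\<bar> \<le> 2"
          then consider "2 \<le> g x / \<epsilon>" | "g x / \<epsilon> \<le> - 2" by linarith
          then have "\<theta> x = 0"
            by cases (simp_all add: \<theta>_def u_def K0 K1)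
          with True show False by blast
        qed
        then have "x \<in> A" using True \<epsilon>(1) by (intro A_I) (auto simp: field_simps)
        moreover have "\<bar>\<theta> x\<bar> \<le> 2 * M"
          using KM[of "g x / \<epsilon> + 2"] KM[of "g x / \<epsilon> - 1"] unfolding \<theta>_def u_def by linarith
        ultimately show ?thesis
          using mult_mono[of "\<bar>\<theta> x\<bar>" "2 * M" "norm (dW x \<bullet> d\<psi> x)" M2] M2 True \<open>0 \<le> M\<close> by (simp add: abs_mult)
      next
        case False
        then have "norm (\<theta> x * (dW x \<bullet> d\<psi> x)) = 0" using d\<psi>0[of x] by auto
        also have "0 \<le> 2 * M * M2 * indicator A x" using \<open>0 \<le> M\<close> M2(1) by simp
        finally show ?thesis .
      qed
    qed
    also have "\<dots> \<le> (2 * M * M2) * (C * \<epsilon>)"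
      using \<open>measure lborel A \<le> C * \<epsilon>\<close> \<open>0 \<le> M\<close> M2(1) by (simp add: mult_left_mono)
    also have "\<dots> \<le> (2 * M * M2 * C + 1) * \<epsilon>" using \<epsilon>(1) by (simp add: algebra_simps)
    also have "\<dots> \<le> \<eta> / 2" using \<epsilon>(4) pos(2) by (simp add: field_simps)
    finally show ?thesis by simp
  qed
  have I2: "\<bar>\<integral>x. G x \<bullet> d\<theta> x \<partial>lborel\<bar> \<le> \<eta> / 2"
  proof -
    define J where "J c x = (G x \<bullet> dg x) * K' (g x / \<epsilon> + c)" for c x
    have cJ: "continuous_on UNIV (J c)" for c
      unfolding J_def using \<epsilon>(1)
      by (intro continuous_intros cG cg continuous_on_compose2[OF cK']) (auto intro!: continuous_intros cg)
    have intJ: "integrable lborel (J c)" for c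
      by (rule integrable_compact_support[OF cJ, of R]) (auto simp: J_def G0)
    \<comment> \<open>Shifting \<open>J 2\<close> by \<open>-2 * \<epsilon>\<close> and
      \<open>J (- 1)\<close> by \<open>\<epsilon>\<close> along \<open>e\<close> turns both
      arguments of \<open>K'\<close> into \<open>g x / \<epsilon>\<close>. The integrands then
      differ only in where \<open>G\<close> is evaluated.\<close>
    define D where "D x = ((G (x - (2 * \<epsilon>) *\<^sub>R e) - G (x + \<epsilon> *\<^sub>R e)) \<bullet> dg x) * K' (g x / \<epsilon>)" for x
    have "g (x + (-2 * \<epsilon>) *\<^sub>R e) = g x + (- 2 * \<epsilon>)" for x by (rule gt)
    then have J1: "J 2 (x + (-2 * \<epsilon>) *\<^sub>R e) = (G (x - (2 * \<epsilon>) *\<^sub>R e) \<bullet> dg x) * K' (g x / \<epsilon>)" for x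
      using \<epsilon>(1) dgt[of x "-2 * \<epsilon>"] by (simp add: J_def diff_divide_distrib)
    have J2: "J (- 1) (x + \<epsilon> *\<^sub>R e) = (G (x + \<epsilon> *\<^sub>R e) \<bullet> dg x) * K' (g x / \<epsilon>)" for x
      using \<epsilon>(1) dgt[of x \<epsilon>] by (simp add: J_def gt add_divide_distrib)
    have Deq: "D x = J 2 (x + (-2 * \<epsilon>) *\<^sub>R e) - J (- 1) (x + \<epsilon> *\<^sub>R e)" for x
      unfolding D_def J1 J2 by (simp add: inner_diff_left left_diff_distrib)
    have sh: "integrable lborel (\<lambda>x. J c (x + a))" for c and a :: 'a
    proof (rule integrable_compact_support[where R = "R + norm a"])
      show "continuous_on UNIV (\<lambda>x. J c (x + a))"
        by (rule continuous_on_compose2[OF cJ]) (auto intro!: continuous_intros)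
      fix x :: 'a assume "R + norm a \<le> norm x"
      then have "R \<le> norm (x + a)" using norm_diff_ineq[of x a] by linarith
      then show "J c (x + a) = 0" by (simp add: J_def G0)
    qed
    have intD: "integrable lborel D"
      unfolding Deq[abs_def] by (intro Bochner_Integration.integrable_diff sh)
    have "G x \<bullet> d\<theta> x = (J 2 x - J (- 1) x) / \<epsilon>" for x
      unfolding d\<theta>_def u'_def J_def by (simp add: algebra_simps diff_divide_distrib)
    then have "(\<integral>x. G x \<bullet> d\<theta> x \<partial>lborel) = ((\<integral>x. J 2 x \<partial>lborel) - (\<integral>x. J (- 1) x \<partial>lborel)) / \<epsilon>"
      by (simp add: Bochner_Integration.integral_diff[OF intJ intJ])
    also have "(\<integral>x. J 2 x \<partial>lborel) - (\<integral>x. J (- 1) x \<partial>lborel)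
        = (\<integral>x. J 2 (x + (-2 * \<epsilon>) *\<^sub>R e) \<partial>lborel) - (\<integral>x. J (- 1) (x + \<epsilon> *\<^sub>R e) \<partial>lborel)"
      by (simp only: lborel_integral_shift[OF borel_measurable_continuous_onI[OF cJ]])
    also have "\<dots> = (\<integral>x. D x \<partial>lborel)"
      unfolding Deq by (rule Bochner_Integration.integral_diff[OF sh sh, symmetric])
    finally have eq: "(\<integral>x. G x \<bullet> d\<theta> x \<partial>lborel) = (\<integral>x. D x \<partial>lborel) / \<epsilon>" .
    \<comment> \<open>The volume \<open>C * \<epsilon>\<close> of the layer cancels the remaining
      factor \<open>1 / \<epsilon>\<close>, so the small factor \<open>\<omega>\<close>
      survives.\<close>
    have "norm (\<integral>x. D x \<partial>lborel) \<le> (\<integral>x. (\<omega> * L * M) * indicator A x \<partial>lborel)"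
    proof (rule Bochner_Integration.integral_norm_bound_integral[OF intD intA])
      fix x
      have ne: "norm ((2 * \<epsilon>) *\<^sub>R e) = 2 * \<epsilon>" "norm (\<epsilon> *\<^sub>R e) = \<epsilon>" using e \<epsilon>(1) by auto
      show "norm (D x) \<le> \<omega> * L * M * indicator A x"
      proof (cases "norm x \<le> R + 3 \<and> K' (g x / \<epsilon>) \<noteq> 0")
        case True
        have "0 < g x / \<epsilon>" "g x / \<epsilon> < 1" using K'0[of "g x / \<epsilon>"] True by force+
        then have "x \<in> A" using True \<epsilon>(1) by (intro A_I) (auto simp: field_simps)
        have n: "norm (x - (2 * \<epsilon>) *\<^sub>R e) \<le> R + 5" "norm (x + \<epsilon> *\<^sub>R e) \<le> R + 5"
          using True norm_triangle_ineq4[of x "(2 * \<epsilon>) *\<^sub>R e"] norm_triangle_ineq[of x "\<epsilon> *\<^sub>R e"] \<epsilon>(2)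
          unfolding ne by linarith+
        have "dist (x - (2 * \<epsilon>) *\<^sub>R e) (x + \<epsilon> *\<^sub>R e) = norm ((- 3 * \<epsilon>) *\<^sub>R e)"
          unfolding dist_norm by (rule arg_cong[of _ _ norm]) (simp add: algebra_simps flip: scaleR_add_left)
        also have "\<dots> < d" using e \<epsilon>(1,3) by simp
        finally have "norm (G (x - (2 * \<epsilon>) *\<^sub>R e) - G (x + \<epsilon> *\<^sub>R e)) \<le> \<omega>"
          using d(2)[OF n] by (simp add: dist_norm)
        then have "norm (G (x - (2 * \<epsilon>) *\<^sub>R e) - G (x + \<epsilon> *\<^sub>R e)) * norm (dg x) \<le> \<omega> * L"
          using dgL[of x] True \<open>0 < \<omega>\<close> by (intro mult_mono) auto
        then have "\<bar>(G (x - (2 * \<epsilon>) *\<^sub>R e) - G (x + \<epsilon> *\<^sub>R e)) \<bullet> dg x\<bar> \<le> \<omega> * L"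
          using Cauchy_Schwarz_ineq2 order_trans by blast
        then have "norm (D x) \<le> \<omega> * L * M"
          unfolding D_def real_norm_def abs_mult using K'M \<open>0 < \<omega>\<close> L(1) by (intro mult_mono) auto
        then show ?thesis using \<open>x \<in> A\<close> by simp
      next
        case False
        have "D x = 0"
        proof (cases "norm x \<le> R + 3")
          case far: False
          have "R \<le> norm (x - (2 * \<epsilon>) *\<^sub>R e)" "R \<le> norm (x + \<epsilon> *\<^sub>R e)"
            using far norm_triangle_ineq2[of x "(2 * \<epsilon>) *\<^sub>R e"] norm_diff_ineq[of x "\<epsilon> *\<^sub>R e"] \<epsilon>(2)
            unfolding ne by linarith+
          then show ?thesis by (simp add: D_def G0)
        qed (use False in \<open>simp add: D_def\<close>)
        then have "norm (D x) = 0" by simp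
        also have "0 \<le> \<omega> * L * M * indicator A x" using \<open>0 \<le> M\<close> L(1) \<open>0 < \<omega>\<close> by simp
        finally show ?thesis .
      qed
    qed
    also have "\<dots> \<le> (\<omega> * L * M) * (C * \<epsilon>)"
      using \<open>measure lborel A \<le> C * \<epsilon>\<close> \<open>0 \<le> M\<close> L(1) \<open>0 < \<omega>\<close> by (simp add: mult_left_mono)
    finally have "\<bar>\<integral>x. G x \<bullet> d\<theta> x \<partial>lborel\<bar> \<le> \<omega> * (L * M * C)"
      unfolding eq using \<epsilon>(1) by (simp add: field_simps)
    also have "\<dots> \<le> \<omega> * (L * M * C + 1)" using \<open>0 < \<omega>\<close> by simp
    also have "\<dots> = \<eta> / 2" using pos(1) by (simp add: \<omega>_def field_simps)
    finally show ?thesis .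
  qed
  have "dW x \<bullet> d\<phi> x = G x \<bullet> d\<theta> x + \<theta> x * (dW x \<bullet> d\<psi> x)" for x
    by (simp add: d\<phi>_def G_def inner_add_right)
  moreover have "integrable lborel (\<lambda>x. G x \<bullet> d\<theta> x)"
    by (rule integrable_compact_support[where R = R]) (auto intro!: continuous_intros cG c\<theta> simp: G0)
  moreover have "integrable lborel (\<lambda>x. \<theta> x * (dW x \<bullet> d\<psi> x))"
    by (rule integrable_compact_support[where R = "R + 1"]) (auto intro!: continuous_intros c\<theta> cont simp: d\<psi>0)
  ultimately have "(\<integral>x. dW x \<bullet> d\<phi> x \<partial>lborel) = (\<integral>x. G x \<bullet> d\<theta> x \<partial>lborel) + (\<integral>x. \<theta> x * (dW x \<bullet> d\<psi> x) \<partial>lborel)"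
    by simp
  then have "\<bar>\<integral>x. dW x \<bullet> d\<phi> x \<partial>lborel\<bar> \<le> \<eta>" using I1 I2 by linarith
  with \<phi> \<theta>1 show ?thesis by (rule that)
qed

section \<open>Densities annihilating test functions\<close>

lemma
  assumes \<phi>: "C2_grad \<phi> d\<phi>"
  shows continuous_on_laplacian: "continuous_on UNIV (laplacian \<phi>)"
    and laplacian_zero_outside: "closed K \<Longrightarrow> (\<And>x. x \<notin> K \<Longrightarrow> \<phi> x = 0) \<Longrightarrow> x \<notin> K \<Longrightarrow> laplacian \<phi> x = 0"
proof -
  have \<phi>1: "C1_grad \<phi> d\<phi>" using \<phi> by (rule C2_grad_imp_C1_grad)
  have "\<forall>i\<in>Basis. \<exists>d. C1_grad (\<lambda>x. d\<phi> x \<bullet> i) d"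
    using \<phi> by (auto simp: C2_grad_def C1_fun_def)
  then obtain D where D: "\<And>i. i \<in> Basis \<Longrightarrow> C1_grad (\<lambda>x. d\<phi> x \<bullet> i) (D i)" by metis
  have eq: "laplacian \<phi> x = (\<Sum>i\<in>Basis. D i x \<bullet> i)" for x
    by (simp add: laplacian_def C1_grad_pderivative[OF \<phi>1] C1_grad_pderivative[OF D])
  show "continuous_on UNIV (laplacian \<phi>)"
    unfolding eq[abs_def] by (intro continuous_intros C1_grad_continuous[OF D])
  assume K: "closed K" "\<And>x. x \<notin> K \<Longrightarrow> \<phi> x = 0" and x: "x \<notin> K"
  have "d\<phi> y = 0" if "y \<notin> K" for y using C1_grad_zero_outside[OF \<phi>1 K that] .
  then have "D i x = 0" if "i \<in> Basis" for i
    using C1_grad_zero_outside[OF D[OF that] K(1) _ x] by simp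
  then show "laplacian \<phi> x = 0" by (simp add: eq)
qed

section \<open>C^2 cutoffs for boxes and balls\<close>

lemma box_indicator_approx:
  fixes a b :: "'a::euclidean_space"
  obtains f :: "nat \<Rightarrow> 'a \<Rightarrow> real" and B where "\<And>n. \<exists>d. C2_grad (f n) d" "\<And>n x. x \<notin> box a b \<Longrightarrow> f n x = 0"
    "\<And>n x. \<bar>f n x\<bar> \<le> B" "\<And>x. (\<lambda>n. f n x) \<longlonglongrightarrow> indicator (box a b) x"
proof -
  obtain K K' K'' :: "real \<Rightarrow> real" and M :: real
    where K: "\<And>s. (K has_real_derivative K' s) (at s)" "\<And>s. (K' has_real_derivative K'' s) (at s)"
      "continuous_on UNIV K''" and K0: "\<And>s. s \<le> 0 \<Longrightarrow> K s = 0" and K1: "\<And>s. 1 \<le> s \<Longrightarrow> K s = 1"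
      and KM: "\<And>s. \<bar>K s\<bar> \<le> M"
    using C2_step_function by metis
  \<comment> \<open>Each factor vanishes on or beyond its face, and at each interior point it is
    eventually 1. The limit is therefore the indicator of the open box.\<close>
  define f where "f n x = (\<Prod>i\<in>Basis. K (real n * (x \<bullet> i - a \<bullet> i)) * K (real n * (b \<bullet> i - x \<bullet> i)))" for n x
  have lim: "(\<lambda>n. K (real n * s)) \<longlonglongrightarrow> 1" if "0 < s" for s
  proof (rule tendsto_eventually)
    obtain N :: nat where N: "1 / s < real N" using reals_Archimedean2 by blast
    have "K (real n * s) = 1" if "N \<le> n" for n
    proof (rule K1)
      have "1 / s \<le> real n" using N that by linarith
      then show "1 \<le> real n * s" using \<open>0 < s\<close> by (simp add: field_simps)
    qed
    then show "\<forall>\<^sub>F n in sequentially. K (real n * s) = 1" by (auto simp: eventually_sequentially)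
  qed
  have z: "f n x = 0" if out: "x \<notin> box a b" for n x
  proof -
    obtain i where i: "i \<in> Basis" "x \<bullet> i \<le> a \<bullet> i \<or> b \<bullet> i \<le> x \<bullet> i"
      using out unfolding mem_box by (meson not_less)
    have "K (real n * (x \<bullet> i - a \<bullet> i)) * K (real n * (b \<bullet> i - x \<bullet> i)) = 0"
      using i(2) K0[of "real n * (x \<bullet> i - a \<bullet> i)"] K0[of "real n * (b \<bullet> i - x \<bullet> i)"]
      by (auto simp: mult_nonneg_nonpos)
    then show ?thesis unfolding f_def using i(1) by (intro prod_zero) auto
  qed
  show ?thesis
  proof (rule that[of f "(\<Prod>i\<in>(Basis::'a set). M * M)"])
    fix n
    have lin: "\<exists>d. C2_grad (\<lambda>x::'a. real n * (x \<bullet> i - c)) d" "\<exists>d. C2_grad (\<lambda>x::'a. real n * (c - x \<bullet> i)) d" for i c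
      using C2_grad_mult[OF C2_grad_const C2_grad_diff[OF C2_grad_inner C2_grad_const]]
        C2_grad_mult[OF C2_grad_const C2_grad_diff[OF C2_grad_const C2_grad_inner]] by blast+
    have "\<exists>d. C2_grad (\<lambda>x::'a. K (real n * (x \<bullet> i - a \<bullet> i)) * K (real n * (b \<bullet> i - x \<bullet> i))) d" for i
    proof -
      obtain d1 d2 where "C2_grad (\<lambda>x::'a. real n * (x \<bullet> i - a \<bullet> i)) d1" "C2_grad (\<lambda>x::'a. real n * (b \<bullet> i - x \<bullet> i)) d2"
        using lin by metis
      from C2_grad_mult[OF this[THEN C2_grad_compose[OF K]]] show ?thesis by blast
    qed
    then show "\<exists>d. C2_grad (f n) d" unfolding f_def[abs_def] by (intro C2_grad_prod) auto
    show "\<bar>f n x\<bar> \<le> (\<Prod>i\<in>(Basis::'a set). M * M)" for x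
      unfolding f_def abs_prod using KM by (intro prod_mono) (auto simp: abs_mult intro!: mult_mono order_trans[OF abs_ge_zero KM])
    show "f n x = 0" if "x \<notin> box a b" for x using z[OF that] .
  next
    fix x
    show "(\<lambda>n. f n x) \<longlonglongrightarrow> indicator (box a b) x"
    proof (cases "x \<in> box a b")
      case True
      have "(\<lambda>n. f n x) \<longlonglongrightarrow> (\<Prod>i\<in>(Basis::'a set). 1 * 1)"
        unfolding f_def using True by (intro tendsto_prod tendsto_mult lim) (auto simp: mem_box)
      then show ?thesis using True by simp
    qed (simp add: z)
  qed
qed

lemma ball_cutoff:
  fixes p :: "'a::euclidean_space"
  assumes "0 < s"
  obtains \<zeta> d\<zeta> where "C2_grad \<zeta> d\<zeta>" "\<And>x. dist p x \<le> s \<Longrightarrow> \<zeta> x = 1" "\<And>x. 2 * s \<le> dist p x \<Longrightarrow> \<zeta> x = 0"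
proof -
  obtain K K' K'' :: "real \<Rightarrow> real" and M :: real
    where K: "\<And>s. (K has_real_derivative K' s) (at s)" "\<And>s. (K' has_real_derivative K'' s) (at s)"
      "continuous_on UNIV K''" and K0: "\<And>s. s \<le> 0 \<Longrightarrow> K s = 0" and K1: "\<And>s. 1 \<le> s \<Longrightarrow> K s = 1"
    using C2_step_function by metis
  \<comment> \<open>Between radii \<open>s\<close> and \<open>2 * s\<close> the squared distance
    grows by \<open>3 * s\<^sup>2\<close>, so \<open>q\<close> falls from 1 to 0 there. Using the
    squared distance avoids a singularity at \<open>p\<close>.\<close>
  define c where "c = 1 / (3 * s\<^sup>2)"
  have "0 < c" using assms by (simp add: c_def)
  define q where "q x = c * (4 * s\<^sup>2 - (x - p) \<bullet> (x - p))" for x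
  have "C1_grad q (\<lambda>x. (- 2 * c) *\<^sub>R (x - p))"
    unfolding q_def by (rule C1_gradI) (auto intro!: derivative_eq_intros continuous_intros simp: inner_commute algebra_simps)
  moreover have "C1_grad (\<lambda>x. ((- 2 * c) *\<^sub>R (x - p)) \<bullet> i) (\<lambda>x. (- 2 * c) *\<^sub>R i)" for i
    by (rule C1_gradI) (auto intro!: derivative_eq_intros simp: inner_commute)
  ultimately have q: "C2_grad q (\<lambda>x. (- 2 * c) *\<^sub>R (x - p))"
    unfolding C2_grad_def by (blast intro: C1_funI)
  have sq: "(x - p) \<bullet> (x - p) = (dist p x)\<^sup>2" for x
    unfolding power2_norm_eq_inner[symmetric] dist_norm by (simp add: norm_minus_commute)
  show ?thesis
  proof (rule that[OF C2_grad_compose[OF K q]])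
    fix x assume "dist p x \<le> s"
    then have "(dist p x)\<^sup>2 \<le> s\<^sup>2" by (intro power_mono) auto
    then have "c * (3 * s\<^sup>2) \<le> q x" unfolding q_def sq using \<open>0 < c\<close> by (intro mult_left_mono) auto
    then show "K (q x) = 1" using assms by (intro K1) (simp add: c_def)
  next
    fix x assume "2 * s \<le> dist p x"
    then have "(2 * s)\<^sup>2 \<le> (dist p x)\<^sup>2" using assms by (intro power_mono) auto
    then show "K (q x) = 0" unfolding q_def sq using \<open>0 < c\<close> by (intro K0) (auto simp: mult_nonneg_nonpos)
  qed
qed

section \<open>The interface as a zero set of a height function\<close>

lemma C1_grad_graph_height:
  fixes \<gamma> :: "'a::euclidean_space \<Rightarrow> real"
  assumes "Ck_on 1 \<gamma> UNIV"
  obtains d where "C1_grad (\<lambda>x. x \<bullet> e - \<gamma> (x - (x \<bullet> e) *\<^sub>R e)) d"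
proof -
  obtain d where d: "\<And>x. (\<gamma> has_derivative (\<lambda>v. d x \<bullet> v)) (at x)" "continuous_on UNIV d"
    using Ck_on_1_gradient[OF assms] by auto
  let ?P = "\<lambda>x. x - (x \<bullet> e) *\<^sub>R e"
  have "C1_grad (\<lambda>x. \<gamma> (?P x)) (\<lambda>x. d (?P x) - (d (?P x) \<bullet> e) *\<^sub>R e)"
  proof (rule C1_gradI)
    fix x
    have "(?P has_derivative ?P) (at x)" by (auto intro!: derivative_eq_intros)
    from has_derivative_compose[OF this d(1)]
    have "((\<lambda>x. \<gamma> (?P x)) has_derivative (\<lambda>v. d (?P x) \<bullet> (v - (v \<bullet> e) *\<^sub>R e))) (at x)" .
    then show "((\<lambda>x. \<gamma> (?P x)) has_derivative (\<lambda>v. (d (?P x) - (d (?P x) \<bullet> e) *\<^sub>R e) \<bullet> v)) (at x)"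
      by (simp add: inner_diff_right inner_diff_left inner_commute[of e] mult.commute)
    have "continuous_on UNIV (\<lambda>x. d (?P x))"
      by (rule continuous_on_compose2[OF d(2)]) (auto intro!: continuous_intros)
    then show "continuous_on UNIV (\<lambda>x. d (?P x) - (d (?P x) \<bullet> e) *\<^sub>R e)" by (intro continuous_intros)
  qed
  from C1_grad_diff[OF C1_grad_inner this] show ?thesis by (rule that)
qed

text \<open>A frontier point of an open set lies outside it, so the height is not positive; a
  negative height would persist in a neighbourhood disjoint from \<open>U\<close>. This places the
  interface where the cutoff equals 1.\<close>

lemma frontier_subset_graph:
  fixes h :: "'a::euclidean_space \<Rightarrow> real"
  assumes "open U" and B: "U \<inter> ball p r = {x \<in> ball p r. 0 < h x}" and h: "continuous_on UNIV h"
    and x: "x \<in> frontier U" "x \<in> ball p r"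
  shows "h x = 0"
proof -
  have "x \<notin> U" using x(1) \<open>open U\<close> by (simp add: frontier_def interior_open)
  then have "h x \<le> 0" using B x(2) by force
  moreover have "\<not> h x < 0"
  proof
    assume "h x < 0"
    have V: "open ({y. h y < 0} \<inter> ball p r)"
      by (intro open_Int open_Collect_less h continuous_intros open_ball)
    have "x \<in> closure U" using x(1) by (simp add: frontier_def)
    with \<open>h x < 0\<close> x(2) have "{y. h y < 0} \<inter> ball p r \<inter> closure U \<noteq> {}" by blast
    then obtain y where "y \<in> U" "h y < 0" "y \<in> ball p r"
      using open_Int_closure_eq_empty[OF V, of U] by blast
    then show False using B by force
  qed
  ultimately show ?thesis by simp
qed

text \<open>A signed density that annihilates \<open>C\<^sup>2\<close> test functions has integral zero over Borel sets (Dynkin),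
  and Borel hulls carry this over to the Caratheodory measurable sets \<open>{q > c}\<close>.\<close>

lemma hausdorff_AE_nonpos_if_test_functions:
  fixes q :: "'a::euclidean_space \<Rightarrow> real" and k :: nat
  defines "M \<equiv> hausdorff_measure k :: 'a measure"
  assumes int: "integrable M q"
    and test: "\<And>\<psi> d\<psi>. C2_grad \<psi> d\<psi> \<Longrightarrow> (\<And>x. x \<notin> box a b \<Longrightarrow> \<psi> x = 0) \<Longrightarrow> (\<integral>x. q x * \<psi> x \<partial>M) = 0"
  shows "AE x in M. x \<in> box a b \<longrightarrow> q x \<le> 0"
proof -
  have spM [simp]: "space M = UNIV" by (simp add: M_def)
  have bM: "A \<in> sets M" if "A \<in> sets borel" for A
    using that sets_borel_subset_hausdorff_measure unfolding M_def by blast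
  have mM: "f \<in> borel_measurable M" if "f \<in> borel_measurable borel" for f :: "'a \<Rightarrow> real"
    using that measurable_sets[OF that] by (intro measurableI) (auto intro!: bM)
  have [measurable]: "q \<in> borel_measurable M" using int by (rule borel_measurable_integrable)
  have intI: "integrable M (\<lambda>x. q x * indicator A x)" if "A \<in> sets M" for A
    by (rule integrable_real_mult_indicator[OF that int])
  have box0: "(\<integral>x. q x * indicator (box c d \<inter> box a b) x \<partial>M) = 0" for c d
  proof -
    obtain a' b' where ab: "box c d \<inter> box a b = box a' b'" using box_Int_box by blast
    obtain f B where f: "\<And>n. \<exists>d. C2_grad (f n) d" "\<And>n x. x \<notin> box a' b' \<Longrightarrow> f n x = 0"
      "\<And>n x. \<bar>f n x\<bar> \<le> B" "\<And>x. (\<lambda>n. f n x) \<longlonglongrightarrow> indicator (box a' b') x"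
      using box_indicator_approx[of a' b'] by metis
    have "(\<lambda>n. \<integral>x. q x * f n x \<partial>M) \<longlonglongrightarrow> (\<integral>x. q x * indicator (box a' b') x \<partial>M)"
    proof (rule integral_dominated_convergence[where w = "\<lambda>x. B * \<bar>q x\<bar>"])
      have fm [measurable]: "f n \<in> borel_measurable M" for n
      proof -
        obtain d where "C2_grad (f n) d" using f(1) by blast
        from C1_grad_continuous_fun[OF C2_grad_imp_C1_grad[OF this]] show ?thesis
          by (intro mM borel_measurable_continuous_onI)
      qed
      have [measurable]: "box a' b' \<in> sets M" by (rule bM) simp
      show "(\<lambda>x. q x * indicator (box a' b') x) \<in> borel_measurable M" by measurable
      show "(\<lambda>x. q x * f n x) \<in> borel_measurable M" for n by measurable
      show "integrable M (\<lambda>x. B * \<bar>q x\<bar>)" using int by simp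
      show "AE x in M. (\<lambda>n. q x * f n x) \<longlonglongrightarrow> q x * indicator (box a' b') x"
        by (intro AE_I2 tendsto_mult tendsto_const f(4))
      show "AE x in M. norm (q x * f n x) \<le> B * \<bar>q x\<bar>" for n
      proof (rule AE_I2)
        show "norm (q x * f n x) \<le> B * \<bar>q x\<bar>" for x
          using mult_right_mono[OF f(3)[of n x], of "\<bar>q x\<bar>"] by (simp add: abs_mult mult.commute[of "\<bar>q x\<bar>"])
      qed
    qed
    moreover have "(\<integral>x. q x * f n x \<partial>M) = 0" for n
    proof -
      obtain d where d: "C2_grad (f n) d" using f(1) by blast
      show ?thesis by (rule test[OF d]) (use f(2) ab in blast)
    qed
    ultimately show ?thesis unfolding ab by (simp add: LIMSEQ_const_iff)
  qed
  \<comment> \<open>The set function is signed, so uniqueness of measures does not apply directly;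
    the Dynkin induction uses its additivity. Complements are taken within \<open>box a b\<close>,
    whose own integral vanishes by \<open>box0\<close>.\<close>
  have borel0: "(\<integral>x. q x * indicator (A \<inter> box a b) x \<partial>M) = 0" if "A \<in> sets borel" for A
  proof -
    let ?G = "range (\<lambda>(a, b). box a b :: 'a set)"
    have stable: "Int_stable ?G" by (auto simp: Int_stable_def box_Int_box)
    have sig: "sigma_sets UNIV ?G = sets borel" by (simp add: borel_eq_box)
    have "A \<in> sigma_sets UNIV ?G" using that by (simp only: sig)
    then show ?thesis
    proof (rule sigma_sets_induct_disjoint[OF stable subset_UNIV[of ?G, folded Pow_UNIV]])
      show "(\<integral>x. q x * indicator (A \<inter> box a b) x \<partial>M) = 0" if "A \<in> ?G" for A
        using that box0 by auto
      show "(\<integral>x. q x * indicator ({} \<inter> box a b) x \<partial>M) = 0" by simp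
    next
      fix A assume A: "A \<in> sigma_sets UNIV ?G" and A0: "(\<integral>x. q x * indicator (A \<inter> box a b) x \<partial>M) = 0"
      have [measurable]: "A \<in> sets borel" using A by (simp only: sig)
      have "(\<integral>x. q x * indicator ((UNIV - A) \<inter> box a b) x \<partial>M)
          = (\<integral>x. q x * indicator (box a b) x - q x * indicator (A \<inter> box a b) x \<partial>M)"
        by (rule Bochner_Integration.integral_cong) (auto simp: indicator_def)
      also have "\<dots> = (\<integral>x. q x * indicator (box a b) x \<partial>M) - (\<integral>x. q x * indicator (A \<inter> box a b) x \<partial>M)"
        by (intro Bochner_Integration.integral_diff intI bM) auto
      finally show "(\<integral>x. q x * indicator ((UNIV - A) \<inter> box a b) x \<partial>M) = 0"
        using box0[of a b] A0 by simp
    next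
      fix A :: "nat \<Rightarrow> 'a set"
      assume dis: "disjoint_family A" and A: "range A \<subseteq> sigma_sets UNIV ?G"
        and A0: "\<And>i. (\<integral>x. q x * indicator (A i \<inter> box a b) x \<partial>M) = 0"
      have Ab: "A i \<in> sets borel" for i using A sig by blast
      have "(\<integral>x. q x * indicator ((\<Union>i. A i) \<inter> box a b) x \<partial>M) = (LINT x:(\<Union>i. A i \<inter> box a b)|M. q x)"
        unfolding set_lebesgue_integral_def
        by (rule Bochner_Integration.integral_cong) (auto simp: indicator_def)
      also have "\<dots> = (\<Sum>i. LINT x:(A i \<inter> box a b)|M. q x)"
      proof (rule lebesgue_integral_countable_add)
        show "A i \<inter> box a b \<in> sets M" for i using Ab by (intro bM) auto
        show "(A i \<inter> box a b) \<inter> (A j \<inter> box a b) = {}" if "i \<noteq> j" for i j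
          using dis that by (auto simp: disjoint_family_on_def)
        have "(\<Union>i. A i \<inter> box a b) \<in> sets M" using Ab by (intro bM) auto
        from intI[OF this] show "set_integrable M (\<Union>i. A i \<inter> box a b) q"
          by (simp add: set_integrable_def mult.commute)
      qed
      also have "\<dots> = 0" using A0 by (simp add: set_lebesgue_integral_def mult.commute)
      finally show "(\<integral>x. q x * indicator ((\<Union>i. A i) \<inter> box a b) x \<partial>M) = 0" .
    qed
  qed
  have "AE x in M. x \<in> box a b \<longrightarrow> q x \<le> 1 / real (Suc n)" for n
  proof -
    have [measurable]: "box a b \<in> sets M" by (rule bM) simp
    \<comment> \<open>By Markov's inequality the positive threshold makes \<open>A\<close> of finite
      measure, as the Borel hull requires; the set where \<open>q\<close> is merely positive may
      have infinite measure.\<close>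
    define A where "A = {x \<in> box a b. 1 / real (Suc n) < q x}"
    have A [measurable]: "A \<in> sets M"
    proof -
      have "A = {x \<in> space M. x \<in> box a b \<and> 1 / real (Suc n) < q x}" by (auto simp: A_def)
      then show ?thesis by simp
    qed
    have "emeasure M A < top"
    proof -
      have "emeasure M A \<le> emeasure M {x \<in> space M. 1 \<le> ennreal (real (Suc n)) * ennreal \<bar>q x\<bar>}"
      proof (rule emeasure_mono)
        show "A \<subseteq> {x \<in> space M. 1 \<le> ennreal (real (Suc n)) * ennreal \<bar>q x\<bar>}"
        proof
          fix x assume "x \<in> A"
          then have "1 / real (Suc n) < q x" by (simp add: A_def)
          then have "1 < q x * real (Suc n)" by (simp add: pos_divide_less_eq del: of_nat_Suc)
          also have "\<dots> \<le> \<bar>q x\<bar> * real (Suc n)" by (intro mult_right_mono) auto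
          finally have "1 \<le> real (Suc n) * \<bar>q x\<bar>" by (simp add: mult.commute del: of_nat_Suc)
          then have "ennreal 1 \<le> ennreal (real (Suc n) * \<bar>q x\<bar>)" by (intro ennreal_leI)
          then show "x \<in> {x \<in> space M. 1 \<le> ennreal (real (Suc n)) * ennreal \<bar>q x\<bar>}"
            by (simp add: ennreal_mult del: of_nat_Suc)
        qed
      qed measurable
      also have "\<dots> \<le> ennreal (real (Suc n)) * (\<integral>\<^sup>+x. ennreal \<bar>q x\<bar> * indicator (space M) x \<partial>M)"
        by (rule nn_integral_Markov_inequality) (use sets.top[of M] in auto)
      also have "\<dots> < top"
        using int by (simp add: integrable_iff_bounded ennreal_mult_less_top)
      finally show ?thesis .
    qed
    moreover have eqM: "emeasure M A = hausdorff_outer k A"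
      using A emeasure_hausdorff_measure unfolding M_def by blast
    ultimately obtain B where B: "A \<subseteq> B" "B \<in> sets borel" "hausdorff_outer k B = hausdorff_outer k A"
      using hausdorff_outer_borel_hull by metis
    have BM [measurable]: "B \<in> sets M" using B(2) by (rule bM)
    have "emeasure M B = emeasure M A"
      using eqM B(3) BM emeasure_hausdorff_measure unfolding M_def by metis
    then have "emeasure M (B - A) = 0"
      using \<open>emeasure M A < top\<close> B(1) by (subst emeasure_Diff) auto
    then have nullBA: "B - A \<in> null_sets M" by (intro null_setsI) auto
    \<comment> \<open>The hull exceeds \<open>A\<close> by a null set, so the Borel statement
      applies to \<open>A\<close>. As \<open>q\<close> is positive there, the zero integral forces
      \<open>A\<close> to be null.\<close>
    have "(\<integral>x. q x * indicator A x \<partial>M) = (\<integral>x. q x * indicator (B \<inter> box a b) x \<partial>M)"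
    proof (rule integral_cong_AE)
      show "AE x in M. q x * indicator A x = q x * indicator (B \<inter> box a b) x"
        using AE_not_in[OF nullBA] by eventually_elim (use B(1) in \<open>auto simp: indicator_def A_def\<close>)
    qed measurable
    then have "(\<integral>x. q x * indicator A x \<partial>M) = 0" using borel0[OF B(2)] by simp
    moreover have nn: "0 \<le> q x * indicator A x" for x
    proof (cases "x \<in> A")
      case True
      have "0 < 1 / real (Suc n)" by simp
      also have "\<dots> < q x" using True by (simp add: A_def)
      finally show ?thesis by simp
    qed simp
    ultimately have "AE x in M. q x * indicator A x = 0"
      using integral_nonneg_eq_0_iff_AE[OF intI[OF A]] by simp
    then show ?thesis
    proof eventually_elim
      case (elim x)
      show ?case
      proof (intro impI leI notI)
        assume x: "x \<in> box a b" "1 / real (Suc n) < q x"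
        then have "x \<in> A" by (simp add: A_def)
        have "0 < 1 / real (Suc n)" by simp
        also note x(2)
        finally show False using elim \<open>x \<in> A\<close> by simp
      qed
    qed
  qed
  then have "AE x in M. \<forall>n. x \<in> box a b \<longrightarrow> q x \<le> 1 / real (Suc n)" unfolding AE_all_countable by blast
  then show ?thesis
  proof eventually_elim
    case (elim x)
    show ?case
    proof (intro impI leI notI)
      assume x: "x \<in> box a b" "0 < q x"
      from reals_Archimedean[OF x(2)] obtain n where "1 / real (Suc n) < q x"
        unfolding inverse_eq_divide by blast
      with elim x(1) show False by (meson not_le)
    qed
  qed
qed

section \<open>Local analysis at the interface\<close>

lemma integral_lebesgue_on_eq_lborel:
  fixes f :: "'a::euclidean_space \<Rightarrow> real"
  assumes "open U" "f \<in> borel_measurable borel" "\<And>x. x \<notin> U \<Longrightarrow> f x = 0"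
  shows "(\<integral>x. f x \<partial>lebesgue_on U) = (\<integral>x. f x \<partial>lborel)"
proof -
  have "U \<inter> space lebesgue \<in> sets lebesgue" using \<open>open U\<close> by auto
  then have "(\<integral>x. f x \<partial>lebesgue_on U) = (\<integral>x. indicator U x *\<^sub>R f x \<partial>lebesgue)"
    by (rule integral_restrict_space)
  also have "\<dots> = (\<integral>x. f x \<partial>lebesgue)"
    using assms(3) by (intro Bochner_Integration.integral_cong) (auto simp: indicator_def)
  also have "\<dots> = (\<integral>x. f x \<partial>lborel)"
    using assms(2) by (intro integral_completion) simp
  finally show ?thesis .
qed

text \<open>Multiplying a test function by the cutoff leaves the surface integral unchanged, since
  the cutoff is 1 on the interface, while the volume integral becomes arbitrarily small.\<close>

lemma local_test_functions_vanish:
  fixes \<Omega> \<Omega>' :: "'a::euclidean_space set"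
  assumes \<Omega>: "open \<Omega>" and \<Omega>': "open \<Omega>'" "closure \<Omega>' \<subseteq> \<Omega>" "C1_holder_boundary \<beta> \<Omega>'"
    and weak: "weak_solution \<Omega> (frontier \<Omega>') Q v" and w: "Ck_on 1 w \<Omega>" "AE x in lebesgue_on \<Omega>. v x = w x"
    and p: "p \<in> frontier \<Omega>'"
  obtains a b where "p \<in> box a b"
    "\<And>\<psi> d\<psi>. C2_grad \<psi> d\<psi> \<Longrightarrow> (\<And>x. x \<notin> box a b \<Longrightarrow> \<psi> x = 0) \<Longrightarrow>
       (\<integral>x. Q x * \<psi> x \<partial>surface_measure (frontier \<Omega>')) = 0"
proof -
  obtain r e \<gamma> where r: "0 < r" and e: "norm e = 1" and \<gamma>: "C1_holder_on \<beta> \<gamma> UNIV"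
    and graph: "\<Omega>' \<inter> ball p r = {x \<in> ball p r. x \<bullet> e > \<gamma> (x - (x \<bullet> e) *\<^sub>R e)}"
    using bspec[OF \<Omega>'(3)[unfolded C1_holder_boundary_def boundary_of_class_def] p] by blast
  define h where "h x = x \<bullet> e - \<gamma> (x - (x \<bullet> e) *\<^sub>R e)" for x
  obtain dh where h: "C1_grad h dh"
    using C1_grad_graph_height[of \<gamma> e] \<gamma> unfolding h_def C1_holder_on_def by blast
  have ee: "e \<bullet> e = 1" using e by (simp add: norm_eq_1)
  have ht: "h (x + t *\<^sub>R e) = h x + t" for x t
  proof -
    have eq: "x + t *\<^sub>R e - ((x + t *\<^sub>R e) \<bullet> e) *\<^sub>R e = x - (x \<bullet> e) *\<^sub>R e"
      by (simp add: inner_add_left ee algebra_simps)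
    show ?thesis unfolding h_def eq by (simp add: inner_add_left ee)
  qed
  have h0: "h x = 0" if "x \<in> frontier \<Omega>'" "x \<in> ball p r" for x
  proof (rule frontier_subset_graph[OF \<Omega>'(1) _ C1_grad_continuous_fun[OF h] that])
    show "\<Omega>' \<inter> ball p r = {x \<in> ball p r. 0 < h x}" unfolding graph h_def by auto
  qed
  have "p \<in> \<Omega>" using p \<Omega>'(2) by (auto simp: frontier_def)
  with \<Omega> obtain r' where r': "0 < r'" "ball p r' \<subseteq> \<Omega>" using openE by blast
  \<comment> \<open>The doubled radius must stay inside both the ball of the graph description and a
    ball contained in \<open>\<Omega>\<close>.\<close>
  define s where "s = min r r' / 3"
  have s: "0 < s" "2 * s < r" "2 * s < r'" using r r'(1) by (auto simp: s_def)
  have cb: "cball p (2 * s) \<subseteq> \<Omega>" using r'(2) s(3) by (auto simp: subset_iff)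
  obtain \<zeta> d\<zeta> where \<zeta>: "C2_grad \<zeta> d\<zeta>" and \<zeta>1: "\<And>x. dist p x \<le> s \<Longrightarrow> \<zeta> x = 1"
    and \<zeta>0: "\<And>x. 2 * s \<le> dist p x \<Longrightarrow> \<zeta> x = 0"
    using ball_cutoff[OF s(1)] by blast
  obtain dw where dw: "\<And>x. x \<in> \<Omega> \<Longrightarrow> (w has_derivative (\<lambda>v. dw x \<bullet> v)) (at x)" "continuous_on \<Omega> dw"
    using Ck_on_1_gradient[OF w(1)] by blast
  \<comment> \<open>Test functions are supported within \<open>cball p s\<close>, where the cutoff
    is 1, so \<open>W\<close> can replace \<open>w\<close> and is C^1 on the whole space.\<close>
  define W where "W x = w x * \<zeta> x" for x
  obtain dW where W: "C1_grad W dW"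
    using C1_grad_localize[OF dw \<Omega> C2_grad_imp_C1_grad[OF \<zeta>] closed_cball cb] \<zeta>0 unfolding W_def by fastforce
  obtain a b where ab: "p \<in> box a b" "box a b \<subseteq> ball p s"
    using rational_boxes[OF s(1), of p] by blast
  show ?thesis
  proof (rule that[OF ab(1)])
    fix \<psi> d\<psi> assume \<psi>: "C2_grad \<psi> d\<psi>" and \<psi>0: "\<And>x. x \<notin> box a b \<Longrightarrow> \<psi> x = 0"
    define R where "R = norm p + s"
    have small: "norm x < R" if "x \<in> ball p s" for x
    proof -
      have "norm x \<le> norm p + dist p x" by norm
      then show ?thesis using that by (simp add: R_def)
    qed
    have supp: "\<psi> x = 0" if "R \<le> norm x" for x
      using small[of x] that ab(2) by (intro \<psi>0) force
    let ?I = "\<integral>x. Q x * \<psi> x \<partial>surface_measure (frontier \<Omega>')"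
    have "\<bar>?I\<bar> \<le> \<eta>" if \<eta>: "0 < \<eta>" for \<eta>
    proof -
      obtain \<theta> d\<phi> where \<phi>: "C2_grad (\<lambda>x. \<psi> x * \<theta> x) d\<phi>"
        and \<theta>1: "\<And>x. h x = 0 \<Longrightarrow> norm x < R \<Longrightarrow> \<theta> x = 1" and small_I: "\<bar>\<integral>x. dW x \<bullet> d\<phi> x \<partial>lborel\<bar> \<le> \<eta>"
        using thin_cutoff[OF W \<psi> supp h e ht \<eta>] by blast
      define \<phi>f where "\<phi>f x = \<psi> x * \<theta> x" for x
      have \<phi>: "C2_grad \<phi>f d\<phi>" using \<phi> by (simp add: \<phi>f_def[abs_def])
      have \<phi>0: "\<phi>f x = 0" if "x \<notin> ball p s" for x
      proof -
        have "x \<notin> box a b" using that ab(2) by blast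
        then show ?thesis by (simp add: \<phi>f_def \<psi>0)
      qed
      have lap0: "laplacian \<phi>f x = 0" if "x \<notin> cball p s" for x
        using laplacian_zero_outside[OF \<phi> closed_cball _ that] \<phi>0 by force
      have clap: "continuous_on UNIV (laplacian \<phi>f)" using continuous_on_laplacian[OF \<phi>] .
      have cW: "continuous_on UNIV W" using C1_grad_continuous_fun[OF W] .
      have "\<phi>f x = 0" if "x \<in> frontier \<Omega>" for x
      proof (rule \<phi>0)
        have "x \<notin> \<Omega>" using that \<Omega> by (simp add: frontier_def interior_open)
        then show "x \<notin> ball p s" using cb s(1) by force
      qed
      then have "- (\<integral>x. v x * laplacian \<phi>f x \<partial>lebesgue_on \<Omega>) = (\<integral>x. Q x * \<phi>f x \<partial>surface_measure (frontier \<Omega>'))"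
        using weak C2_grad_Ck_closure[OF \<phi>] unfolding weak_solution_def by blast
      also have "(\<integral>x. Q x * \<phi>f x \<partial>surface_measure (frontier \<Omega>')) = ?I"
      proof (rule Bochner_Integration.integral_cong[OF refl])
        fix x assume "x \<in> space (surface_measure (frontier \<Omega>'))"
        then have x: "x \<in> frontier \<Omega>'" by (simp add: surface_measure_def space_restrict_space)
        show "Q x * \<phi>f x = Q x * \<psi> x"
        proof (cases "x \<in> box a b")
          case True
          then have "x \<in> ball p s" using ab(2) by blast
          then have "h x = 0" "norm x < R" using h0[OF x] small s by auto
          then show ?thesis by (simp add: \<theta>1 \<phi>f_def)
        qed (simp add: \<psi>0 \<phi>f_def)
      qed
      also have "(\<integral>x. v x * laplacian \<phi>f x \<partial>lebesgue_on \<Omega>) = (\<integral>x. W x * laplacian \<phi>f x \<partial>lebesgue_on \<Omega>)"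
      proof (rule integral_cong_AE)
        have [measurable]: "v \<in> borel_measurable (lebesgue_on \<Omega>)"
          using weak unfolding weak_solution_def by (blast dest: borel_measurable_integrable)
        have [measurable]: "laplacian \<phi>f \<in> borel_measurable (lebesgue_on \<Omega>)" "W \<in> borel_measurable (lebesgue_on \<Omega>)"
          using \<Omega> by (auto intro!: continuous_imp_measurable_on_sets_lebesgue intro: continuous_on_subset[OF clap] continuous_on_subset[OF cW])
        show "(\<lambda>x. v x * laplacian \<phi>f x) \<in> borel_measurable (lebesgue_on \<Omega>)" by measurable
        show "(\<lambda>x. W x * laplacian \<phi>f x) \<in> borel_measurable (lebesgue_on \<Omega>)" by measurable
        show "AE x in lebesgue_on \<Omega>. v x * laplacian \<phi>f x = W x * laplacian \<phi>f x"
          using w(2)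
        proof eventually_elim
          case (elim x)
          show ?case
          proof (cases "x \<in> cball p s")
            case True
            then show ?thesis using elim by (simp add: W_def \<zeta>1)
          qed (simp add: lap0)
        qed
      qed
      also have "\<dots> = (\<integral>x. W x * laplacian \<phi>f x \<partial>lborel)"
      proof (rule integral_lebesgue_on_eq_lborel[OF \<Omega>])
        show "(\<lambda>x. W x * laplacian \<phi>f x) \<in> borel_measurable borel"
          by (intro borel_measurable_continuous_onI continuous_intros cW clap)
        fix x assume "x \<notin> \<Omega>"
        then have "x \<notin> cball p s" using cb s(1) by force
        then show "W x * laplacian \<phi>f x = 0" by (simp add: lap0)
      qed
      also have "\<dots> = - (\<integral>x. dW x \<bullet> d\<phi> x \<partial>lborel)"
        by (rule green_identity[OF W \<phi>, of R]) (use small in \<open>force intro: \<phi>0\<close>)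
      finally show ?thesis using small_I by simp
    qed
    \<comment> \<open>\<open>?I\<close> involves only \<open>\<psi>\<close>, not the cutoff chosen
      for \<open>\<eta>\<close>, so the bound holds for all \<open>\<eta>\<close> at once.\<close>
    then have "\<bar>?I\<bar> \<le> 0 + \<eta>" if "0 < \<eta>" for \<eta> using that by simp
    then have "\<bar>?I\<bar> \<le> 0" by (rule field_le_epsilon)
    then show "?I = 0" by simp
  qed
qed

theorem proposition3p8:
  fixes \<Omega> \<Omega>' \<Gamma> :: "'a::euclidean_space set" and \<beta> :: real and Q v :: "'a \<Rightarrow> real"
  assumes "is_domain \<Omega>" and "bounded \<Omega>" and "smooth_boundary \<Omega>"
    and "is_domain \<Omega>'" and "compactly_contained \<Omega>' \<Omega>"
    and "0 < \<beta>" and "\<beta> < 1" and "C1_holder_boundary \<beta> \<Omega>'"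
    and "\<Gamma> = frontier \<Omega>'"
    and "integrable (surface_measure \<Gamma>) Q"
    and "weak_solution \<Omega> \<Gamma> Q v"
  shows "\<not> has_C1_representative v \<Omega> \<or> (AE x in surface_measure \<Gamma>. Q x = 0)"
proof (cases "has_C1_representative v \<Omega>")
  case True
  then obtain w where w: "Ck_on 1 w \<Omega>" "AE x in lebesgue_on \<Omega>. v x = w x"
    unfolding has_C1_representative_def by blast
  define M where "M = (hausdorff_measure (DIM('a) - 1) :: 'a measure)"
  have open_\<Omega>: "open \<Omega>" and open_\<Omega>': "open \<Omega>'" and sub: "closure \<Omega>' \<subseteq> \<Omega>"
    using assms by (auto simp: is_domain_def compactly_contained_def)
  have \<Gamma>: "\<Gamma> \<inter> space M \<in> sets M"
    unfolding M_def using closed_in_sets_hausdorff_measure[of \<Gamma>] assms(9) by simp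
  \<comment> \<open>Extension by zero moves the problem from the interface to the full Hausdorff
    measure, where boxes and Borel hulls are available.\<close>
  define q where "q x = indicator \<Gamma> x *\<^sub>R Q x" for x
  have int: "integrable M q"
    using assms(10) unfolding surface_measure_def M_def[symmetric] integrable_restrict_space[OF \<Gamma>] q_def .
  have qI: "(\<integral>x. q x * \<psi> x \<partial>M) = (\<integral>x. Q x * \<psi> x \<partial>surface_measure \<Gamma>)" for \<psi>
    unfolding surface_measure_def M_def[symmetric] integral_restrict_space[OF \<Gamma>] q_def by (simp add: mult.assoc)
  have loc: "\<exists>a b. p \<in> box a b \<and> (AE x in M. x \<in> box a b \<longrightarrow> q x = 0)" if p: "p \<in> \<Gamma>" for p
  proof -
    obtain a b where ab: "p \<in> box a b"
      and test: "\<And>\<psi> d\<psi>. C2_grad \<psi> d\<psi> \<Longrightarrow> (\<And>x. x \<notin> box a b \<Longrightarrow> \<psi> x = 0) \<Longrightarrow>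
         (\<integral>x. Q x * \<psi> x \<partial>surface_measure \<Gamma>) = 0"
      using local_test_functions_vanish[OF open_\<Omega> open_\<Omega>' sub assms(8) _ w] assms(9,11) p by metis
    have q0: "(\<integral>x. q x * \<psi> x \<partial>M) = 0" "(\<integral>x. - q x * \<psi> x \<partial>M) = 0"
      if "C2_grad \<psi> d\<psi>" "\<And>x. x \<notin> box a b \<Longrightarrow> \<psi> x = 0" for \<psi> d\<psi>
      using test[OF that] qI[of \<psi>] by simp_all
    have "integrable M (\<lambda>x. - q x)" using int by simp
    then have "AE x in M. x \<in> box a b \<longrightarrow> - q x \<le> 0"
      using hausdorff_AE_nonpos_if_test_functions q0(2) unfolding M_def by blast
    moreover have "AE x in M. x \<in> box a b \<longrightarrow> q x \<le> 0"
      using hausdorff_AE_nonpos_if_test_functions int q0(1) unfolding M_def by blast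
    ultimately have "AE x in M. x \<in> box a b \<longrightarrow> q x = 0" by eventually_elim auto
    with ab show ?thesis by blast
  qed
  \<comment> \<open>Each box has its own exceptional null set. Lindelof reduces to countably many
    boxes, whose null sets may be united.\<close>
  define F where "F = {S. \<exists>a b. S = box a b \<and> (AE x in M. x \<in> S \<longrightarrow> q x = 0)}"
  have "open S" if "S \<in> F" for S using that by (auto simp: F_def)
  then obtain F' where F': "F' \<subseteq> F" "countable F'" "\<Union>F' = \<Union>F" using Lindelof by metis
  have "AE x in M. \<forall>S\<in>F'. x \<in> S \<longrightarrow> q x = 0"
    using F'(1,2) by (intro AE_ball_countable') (auto simp: F_def)
  then have "AE x in M. x \<in> \<Gamma> \<longrightarrow> Q x = 0"
  proof eventually_elim
    case (elim x)
    show ?case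
    proof
      assume "x \<in> \<Gamma>"
      with loc have "x \<in> \<Union>F" by (force simp: F_def)
      with F'(3) elim have "q x = 0" by blast
      with \<open>x \<in> \<Gamma>\<close> show "Q x = 0" by (simp add: q_def)
    qed
  qed
  then have "AE x in surface_measure \<Gamma>. Q x = 0"
    unfolding surface_measure_def M_def[symmetric] AE_restrict_space_iff[OF \<Gamma>] .
  then show ?thesis ..
qed simp

end
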